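(* For all integers $b\ge 2$, \[ F(b)\ge 2[b-1], \] where $2[m]$ denotes the power tower $2^{2^{\cdot^{\cdot^{2}}}}$ with $m$ occurrences of $2$.
   Context: All games are short normal-play two-player combinatorial games (Left and Right; a player unable to move loses), compared up to equality ($Y=Z$ iff $X+Y$ and $X+Z$ have the same outcome for every game $X$, $+$ being the disjunctive sum). The birthday of a game is the maximum length of a sequence of moves (not necessarily alternating) starting from it; a value is born by day $b$ if it equals some game of birthday at most $b$; $\mathbb{G}_b$ is the set of values born by day $b$. A Digraph placement game is played on a finite digraph with vertices coloured blue/red (not necessarily properly): Left chooses a remaining blue vertex and deletes it with all its out-neighbours, Right does the same with a red vertex; a player unable to move loses. For a game $X$, $f(X)$ is the least $n$ such that some Digraph placement game on $n$ vertices equals $X$, and $F(b)=\max_{X\in\mathbb{G}_b}f(X)$. For a real $r$ and integer $m\ge1$, $r[m]$ is the power tower $r^{r^{\cdot^{\cdot^{r}}}}$ with $r$ appearing $m$ times. *)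

theory Defs
  imports Complex_Main "HOL-Library.FSet" "Graph_Theory.Graph_Theory"
begin

datatype game = Game (left_opts: "game fset") (right_opts: "game fset")

lemma size_left_option [termination_simp]:
  assumes "X |\<in>| left_opts G" shows "size X < size G"
proof -
  have "Suc (size X) \<le> (\<Sum>x\<in>fset (left_opts G). Suc (size x))"
    using assms by (intro member_le_sum) auto
  then show ?thesis by (cases G) auto
qed

lemma size_right_option [termination_simp]:
  assumes "X |\<in>| right_opts G" shows "size X < size G"
proof -
  have "Suc (size X) \<le> (\<Sum>x\<in>fset (right_opts G). Suc (size x))"
    using assms by (intro member_le_sum) auto
  then show ?thesis by (cases G) auto
qed

declare fset.map_cong [fundef_cong]

function game_sum :: "game \<Rightarrow> game \<Rightarrow> game"  (infixl \<open>\<oplus>\<^sub>g\<close> 65) where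
  "G \<oplus>\<^sub>g H = Game
     ((\<lambda>X. X \<oplus>\<^sub>g H) |`| left_opts G |\<union>| (\<lambda>Y. G \<oplus>\<^sub>g Y) |`| left_opts H)
     ((\<lambda>X. X \<oplus>\<^sub>g H) |`| right_opts G |\<union>| (\<lambda>Y. G \<oplus>\<^sub>g Y) |`| right_opts H)"
  by pat_completeness auto
termination
  by (relation "measure (\<lambda>(G, H). size G + size H)")
     (auto simp: size_left_option size_right_option)

declare game_sum.simps [simp del]

text \<open>A player to move wins iff some move leaves a position that the opponent, moving next,
  does not win; in particular a player unable to move loses.\<close>

function left_wins_first :: "game \<Rightarrow> bool" and right_wins_first :: "game \<Rightarrow> bool" where
  "left_wins_first G \<longleftrightarrow> (\<exists>X \<in> fset (left_opts G). \<not> right_wins_first X)"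
| "right_wins_first G \<longleftrightarrow> (\<exists>X \<in> fset (right_opts G). \<not> left_wins_first X)"
  by pat_completeness auto
termination
  by (relation "measure (case_sum size size)") (auto simp: size_left_option size_right_option)

declare left_wins_first.simps [simp del] right_wins_first.simps [simp del]

datatype outcome = Left_Wins | Right_Wins | Next_Wins | Previous_Wins

definition outcome :: "game \<Rightarrow> outcome" where
  "outcome G =
     (if left_wins_first G
      then (if right_wins_first G then Next_Wins else Left_Wins)
      else (if right_wins_first G then Right_Wins else Previous_Wins))"

definition game_eq :: "game \<Rightarrow> game \<Rightarrow> bool"  (infix \<open>\<simeq>\<close> 50) where
  "Y \<simeq> Z \<longleftrightarrow> (\<forall>X. outcome (X \<oplus>\<^sub>g Y) = outcome (X \<oplus>\<^sub>g Z))"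

quotient_type game_value = game / game_eq
  morphisms rep_value value_of
  by (intro equivpI reflpI sympI transpI) (auto simp: game_eq_def)

lemma value_of_eq_iff: "value_of G = value_of H \<longleftrightarrow> G \<simeq> H"
  by (fact game_value.abs_eq_iff)

definition move :: "game \<Rightarrow> game \<Rightarrow> bool" where
  "move G X \<longleftrightarrow> X |\<in>| left_opts G \<or> X |\<in>| right_opts G"

definition birthday :: "game \<Rightarrow> nat" where
  "birthday G = Max {n. \<exists>X. (move ^^ n) G X}"

definition values_born_by :: "nat \<Rightarrow> game_value set" where
  "values_born_by b = {value_of G | G. birthday G \<le> b}"

lemma move_sequence_bounded: "(move ^^ n) G X \<Longrightarrow> n \<le> size G"
proof (induction n arbitrary: G)
  case (Suc n)
  then obtain Y where "move G Y" "(move ^^ n) Y X"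
    by (meson relpowp_Suc_D2)
  moreover from \<open>move G Y\<close> have "size Y < size G"
    by (auto simp: move_def size_left_option size_right_option)
  ultimately show ?case using Suc.IH[of Y] by linarith
qed auto

lemma finite_move_sequences: "finite {n. \<exists>X. (move ^^ n) G X}"
  by (rule finite_subset[of _ "{..size G}"]) (auto dest: move_sequence_bounded)

lemma birthday_le_iff: "birthday G \<le> b \<longleftrightarrow> (\<forall>n X. (move ^^ n) G X \<longrightarrow> n \<le> b)"
proof -
  have "(move ^^ 0) G G" by simp
  then have "{n. \<exists>X. (move ^^ n) G X} \<noteq> {}" by blast
  then show ?thesis
    unfolding birthday_def using finite_move_sequences by (subst Max_le_iff) auto
qed

lemma birthday_option:
  assumes "move G X" "birthday G \<le> Suc b" shows "birthday X \<le> b"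
  unfolding birthday_le_iff
proof (intro allI impI)
  fix n Y assume "(move ^^ n) X Y"
  with assms(1) have "(move ^^ Suc n) G Y" by (rule relpowp_Suc_I2)
  with assms(2) show "n \<le> b" unfolding birthday_le_iff by (meson Suc_le_mono)
qed

lemma finite_birthday_le: "finite {G. birthday G \<le> b}"
proof (induction b)
  case 0
  have "G = Game {||} {||}" if "birthday G \<le> 0" for G
  proof -
    have "\<not> move G X" for X
    proof
      assume "move G X"
      then have "(move ^^ 1) G X" by (simp only: relpowp_1)
      moreover have "\<forall>n X. (move ^^ n) G X \<longrightarrow> n \<le> 0"
        using that by (simp only: birthday_le_iff)
      ultimately show False using not_one_le_zero by blast
    qed
    then have "left_opts G = {||}" "right_opts G = {||}" unfolding move_def by blast+
    then show ?thesis by (metis game.collapse)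
  qed
  then have "{G. birthday G \<le> 0} \<subseteq> {Game {||} {||}}" by blast
  then show ?case using finite_subset by blast
next
  case (Suc b)
  let ?S = "{A. fset A \<subseteq> {G. birthday G \<le> b}}"
  have "fset ` ?S \<subseteq> Pow {G. birthday G \<le> b}" by auto
  then have "finite (fset ` ?S)" using Suc.IH by (meson finite_Pow_iff finite_subset)
  then have "finite ?S" by (rule finite_imageD) (simp add: inj_on_def fset_inject)
  moreover have "{G. birthday G \<le> Suc b} \<subseteq> case_prod Game ` (?S \<times> ?S)"
  proof
    fix G assume "G \<in> {G. birthday G \<le> Suc b}"
    then have "left_opts G \<in> ?S" "right_opts G \<in> ?S"
      using birthday_option unfolding move_def by blast+
    then show "G \<in> case_prod Game ` (?S \<times> ?S)"
      by (intro image_eqI[of _ _ "(left_opts G, right_opts G)"]) simp_all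
  qed
  ultimately show ?case by (blast intro: finite_subset finite_imageI finite_SigmaI)
qed

lemma finite_values_born_by: "finite (values_born_by b)"
  unfolding values_born_by_def using finite_birthday_le by (simp add: setcompr_eq_image)

datatype colour = Blue | Red

definition place :: "('v, 'e) pre_digraph \<Rightarrow> 'v \<Rightarrow> ('v, 'e) pre_digraph" where
  "place D v = D \<restriction> (verts D - insert v {u. v \<rightarrow>\<^bsub>D\<^esub> u})"

lemma card_verts_place:
  "finite (verts D) \<Longrightarrow> v \<in> verts D \<Longrightarrow> card (verts (place D v)) < card (verts D)"
  by (auto simp: place_def intro!: psubset_card_mono)

lemma finite_verts_place: "finite (verts D) \<Longrightarrow> finite (verts (place D v))"
  by (simp add: place_def)

text \<open>The finiteness guard only serves the termination proof; the colouring need not be proper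
  and its values outside the vertex set are irrelevant.\<close>

function placement_game :: "('v \<Rightarrow> colour) \<Rightarrow> ('v, 'e) pre_digraph \<Rightarrow> game" where
  "placement_game c D =
     (if finite (verts D) then
        Game (Abs_fset ((\<lambda>v. placement_game c (place D v)) ` {v \<in> verts D. c v = Blue}))
             (Abs_fset ((\<lambda>v. placement_game c (place D v)) ` {v \<in> verts D. c v = Red}))
      else Game {||} {||})"
  by pat_completeness auto
termination
  by (relation "measure (\<lambda>(c, D). card (verts D))") (auto simp: card_verts_place)

declare placement_game.simps [simp del]

lemma placement_game_opts:
  assumes "finite (verts D)"
  shows "fset (left_opts (placement_game c D)) =
           (\<lambda>v. placement_game c (place D v)) ` {v \<in> verts D. c v = Blue}"
    and "fset (right_opts (placement_game c D)) =
           (\<lambda>v. placement_game c (place D v)) ` {v \<in> verts D. c v = Red}"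
  using assms by (subst placement_game.simps; simp add: Abs_fset_inverse)+

text \<open>Vertices are natural numbers and arcs are pairs of them, which represents every finite
  digraph up to isomorphism. The minimum exists because every short game is equal to some
  digraph placement game.\<close>

definition placement_size :: "game_value \<Rightarrow> nat" where
  "placement_size X =
     (LEAST n. \<exists>(D :: (nat, nat \<times> nat) pre_digraph) c.
        digraph D \<and> card (verts D) = n \<and> value_of (placement_game c D) = X)"

definition max_placement_size :: "nat \<Rightarrow> nat" where
  "max_placement_size b = Max (placement_size ` values_born_by b)"

text \<open>\<open>tower r m\<close> has \<open>m\<close> occurrences of \<open>r\<close>, for \<open>m \<ge> 1\<close>.\<close>

definition tower :: "real \<Rightarrow> nat \<Rightarrow> real" where
  "tower r m = ((\<lambda>x. r powr x) ^^ (m - 1)) r"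

end

theory Submission
  imports Defs
begin

text \<open>Let \<open>A\<close> be an antichain of games born by day \<open>b\<close>. For subsets \<open>S\<close> of \<open>A\<close>, the games \<open>{S | -b}\<close>,
  born by day \<open>b + 1\<close>, are ordered by inclusion of \<open>S\<close>. Hence there are at least \<open>2 ^ card A\<close> values
  born by day \<open>b + 1\<close>, and an antichain of \<open>2 ^ (card A div 2)\<close> of them. Since there are fewer than
  \<open>2 ^ (n + 1) ^ 2\<close> placement games with at most \<open>n\<close> vertices, an antichain of 64 games born by
  day 3 yields the bound for all days from 5 on, because \<open>2 ^ 32\<close> is the square of \<open>2[4]\<close>.

  Counting does not reach day 4. There the game \<open>{A | -3}\<close> itself needs 16 vertices when \<open>A\<close> is
  the antichain of 64 games. In a placement game of that value, every element of \<open>A\<close> is reached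
  by a Left move, possibly after some reversed Left moves and their replies. Every reversal
  removes two vertices of each colour, the threat of \<open>-3\<close> needs four red vertices and the elements
  of \<open>A\<close> need blue ones, so on 15 vertices there is at most one reversal, and at most \<open>9 * 7 = 63\<close>
  elements can be reached.

  Days 2 and 3 are settled by \<open>{0 | -(b - 1)}\<close>, which needs \<open>b\<close> red vertices and a blue one.

  That all these games are placement games at all, so that the minimum in \<open>placement_size\<close> is
  attained, follows from the universality of digraph placement.\<close>

section \<open>The order on games\<close>

text \<open>Conway's recursive comparison reads the order off the options alone, without quantifying
  over test games; \<open>game_eq_iff_le\<close> ties it to \<open>game_eq\<close>.\<close>

function game_le :: "game \<Rightarrow> game \<Rightarrow> bool" (infix \<open>\<le>\<^sub>g\<close> 50) where
  "G \<le>\<^sub>g H \<longleftrightarrow> (\<forall>X \<in> fset (left_opts G). \<not> H \<le>\<^sub>g X) \<and> (\<forall>Y \<in> fset (right_opts H). \<not> Y \<le>\<^sub>g G)"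
  by pat_completeness auto
termination
  by (relation "measure (\<lambda>(G, H). size G + size H)")
     (auto dest: size_left_option size_right_option)

declare game_le.simps [simp del]

lemma game_leI:
  assumes "\<And>X. X \<in> fset (left_opts G) \<Longrightarrow> \<not> H \<le>\<^sub>g X"
    and "\<And>Y. Y \<in> fset (right_opts H) \<Longrightarrow> \<not> Y \<le>\<^sub>g G"
  shows "G \<le>\<^sub>g H"
  using assms by (subst game_le.simps) blast

lemma not_game_leE:
  assumes "\<not> G \<le>\<^sub>g H"
  obtains X where "X \<in> fset (left_opts G)" "H \<le>\<^sub>g X"
    | Y where "Y \<in> fset (right_opts H)" "Y \<le>\<^sub>g G"
  using assms by (subst (asm) game_le.simps) blast

lemma game_le_left: "G \<le>\<^sub>g H \<Longrightarrow> X \<in> fset (left_opts G) \<Longrightarrow> \<not> H \<le>\<^sub>g X"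
  by (subst (asm) game_le.simps) blast

lemma game_le_right: "G \<le>\<^sub>g H \<Longrightarrow> Y \<in> fset (right_opts H) \<Longrightarrow> \<not> Y \<le>\<^sub>g G"
  by (subst (asm) game_le.simps) blast

lemma game_le_refl [simp]: "G \<le>\<^sub>g G"
proof (induction "size G" arbitrary: G rule: less_induct)
  case less
  show ?case
  proof (rule game_leI)
    fix X assume X: "X \<in> fset (left_opts G)"
    then show "\<not> G \<le>\<^sub>g X" using less size_left_option game_le_left by blast
  next
    fix Y assume Y: "Y \<in> fset (right_opts G)"
    then show "\<not> Y \<le>\<^sub>g G" using less size_right_option game_le_right by blast
  qed
qed

section \<open>Outcomes of sums and the order\<close>

lemma left_opts_sum:
  "fset (left_opts (G \<oplus>\<^sub>g H)) = (\<lambda>X. X \<oplus>\<^sub>g H) ` fset (left_opts G) \<union> (\<lambda>Y. G \<oplus>\<^sub>g Y) ` fset (left_opts H)"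
  by (subst game_sum.simps) simp

lemma right_opts_sum:
  "fset (right_opts (G \<oplus>\<^sub>g H)) = (\<lambda>X. X \<oplus>\<^sub>g H) ` fset (right_opts G) \<union> (\<lambda>Y. G \<oplus>\<^sub>g Y) ` fset (right_opts H)"
  by (subst game_sum.simps) simp

lemma left_wins_sumI:
  "X \<in> fset (left_opts (G \<oplus>\<^sub>g H)) \<Longrightarrow> \<not> right_wins_first X \<Longrightarrow> left_wins_first (G \<oplus>\<^sub>g H)"
  by (subst left_wins_first.simps) blast

lemma right_wins_sumI:
  "X \<in> fset (right_opts (G \<oplus>\<^sub>g H)) \<Longrightarrow> \<not> left_wins_first X \<Longrightarrow> right_wins_first (G \<oplus>\<^sub>g H)"
  by (subst right_wins_first.simps) blast

text \<open>If Left's winning move in the sum with \<open>G\<close> was to \<open>G'\<close>, then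
  \<open>G \<le> H\<close> excludes \<open>H \<le> G'\<close>: either a Left option of
  \<open>H\<close> is at least \<open>G'\<close>, or a Right option \<open>G''\<close> of
  \<open>G'\<close> lies below \<open>H\<close>, and Left wins moving first once Right has moved to
  \<open>G''\<close>. Each half uses the other on smaller games, so they share one
  induction.\<close>

lemma game_le_sum:
  assumes "G \<le>\<^sub>g H"
  shows "(left_wins_first (X \<oplus>\<^sub>g G) \<longrightarrow> left_wins_first (X \<oplus>\<^sub>g H)) \<and>
         (right_wins_first (X \<oplus>\<^sub>g H) \<longrightarrow> right_wins_first (X \<oplus>\<^sub>g G))"
  using assms
proof (induction "size X + size G + size H" arbitrary: X G H rule: less_induct)
  case less
  have "left_wins_first (X \<oplus>\<^sub>g H)" if lw: "left_wins_first (X \<oplus>\<^sub>g G)"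
  proof -
    from lw obtain P where P: "P \<in> fset (left_opts (X \<oplus>\<^sub>g G))" "\<not> right_wins_first P"
      by (subst (asm) left_wins_first.simps) blast
    then consider X' where "X' \<in> fset (left_opts X)" "P = X' \<oplus>\<^sub>g G"
      | G' where "G' \<in> fset (left_opts G)" "P = X \<oplus>\<^sub>g G'"
      by (auto simp: left_opts_sum)
    then show ?thesis
    proof cases
      case 1
      then have "\<not> right_wins_first (X' \<oplus>\<^sub>g H)"
        using less.hyps[of X' G H] less.prems P(2) size_left_option[of X' X] by auto
      with 1 show ?thesis by (intro left_wins_sumI[of "X' \<oplus>\<^sub>g H"]) (auto simp: left_opts_sum)
    next
      case 2
      have "\<not> H \<le>\<^sub>g G'" using 2 less.prems game_le_left by blast
      then show ?thesis
      proof (cases rule: not_game_leE)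
        case (1 H')
        then have "\<not> right_wins_first (X \<oplus>\<^sub>g H')"
          using less.hyps[of X G' H'] 2 P(2) size_left_option[of G' G] size_left_option[of H' H]
          by auto
        with 1 show ?thesis by (intro left_wins_sumI[of "X \<oplus>\<^sub>g H'"]) (auto simp: left_opts_sum)
      next
        case (2 G'')
        have "left_wins_first (X \<oplus>\<^sub>g G'')"
          using P(2) \<open>P = X \<oplus>\<^sub>g G'\<close> 2 right_wins_sumI[of "X \<oplus>\<^sub>g G''" X G']
          by (auto simp: right_opts_sum)
        then show ?thesis
          using less.hyps[of X G'' H] 2 \<open>G' \<in> fset (left_opts G)\<close> size_left_option[of G' G]
            size_right_option[of G'' G'] by auto
      qed
    qed
  qed
  moreover have "right_wins_first (X \<oplus>\<^sub>g G)" if rw: "right_wins_first (X \<oplus>\<^sub>g H)"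
  proof -
    from rw obtain P where P: "P \<in> fset (right_opts (X \<oplus>\<^sub>g H))" "\<not> left_wins_first P"
      by (subst (asm) right_wins_first.simps) blast
    then consider X' where "X' \<in> fset (right_opts X)" "P = X' \<oplus>\<^sub>g H"
      | H' where "H' \<in> fset (right_opts H)" "P = X \<oplus>\<^sub>g H'"
      by (auto simp: right_opts_sum)
    then show ?thesis
    proof cases
      case 1
      then have "\<not> left_wins_first (X' \<oplus>\<^sub>g G)"
        using less.hyps[of X' G H] less.prems P(2) size_right_option[of X' X] by auto
      with 1 show ?thesis by (intro right_wins_sumI[of "X' \<oplus>\<^sub>g G"]) (auto simp: right_opts_sum)
    next
      case 2
      have "\<not> H' \<le>\<^sub>g G" using 2 less.prems game_le_right by blast
      then show ?thesis
      proof (cases rule: not_game_leE)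
        case (1 H'')
        have "right_wins_first (X \<oplus>\<^sub>g H'')"
          using P(2) \<open>P = X \<oplus>\<^sub>g H'\<close> 1 left_wins_sumI[of "X \<oplus>\<^sub>g H''" X H']
          by (auto simp: left_opts_sum)
        then show ?thesis
          using less.hyps[of X G H''] 1 \<open>H' \<in> fset (right_opts H)\<close> size_right_option[of H' H]
            size_left_option[of H'' H'] by auto
      next
        case (2 G')
        then have "\<not> left_wins_first (X \<oplus>\<^sub>g G')"
          using less.hyps[of X G' H'] \<open>H' \<in> fset (right_opts H)\<close> \<open>P = X \<oplus>\<^sub>g H'\<close> P(2)
            size_right_option[of G' G] size_right_option[of H' H]
          by auto
        with 2 show ?thesis by (intro right_wins_sumI[of "X \<oplus>\<^sub>g G'"]) (auto simp: right_opts_sum)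
      qed
    qed
  qed
  ultimately show ?case by blast
qed

function game_neg :: "game \<Rightarrow> game" where
  "game_neg G = Game (game_neg |`| right_opts G) (game_neg |`| left_opts G)"
  by pat_completeness auto
termination by (relation "measure size") (auto dest: size_left_option size_right_option)

declare game_neg.simps [simp del]

lemma neg_opts:
  "fset (left_opts (game_neg G)) = game_neg ` fset (right_opts G)"
  "fset (right_opts (game_neg G)) = game_neg ` fset (left_opts G)"
  by (subst game_neg.simps; simp)+

text \<open>The test game \<open>game_neg H\<close> turns the order into an outcome: unfolding one
  move gives exactly the recursion of \<open>game_le\<close>.\<close>

lemma neg_sum_outcome:
  "(left_wins_first (game_neg H \<oplus>\<^sub>g G) \<longleftrightarrow> \<not> G \<le>\<^sub>g H) \<and>
   (right_wins_first (game_neg H \<oplus>\<^sub>g G) \<longleftrightarrow> \<not> H \<le>\<^sub>g G)"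
proof (induction "size H + size G" arbitrary: G H rule: less_induct)
  case less
  have "left_wins_first (game_neg H \<oplus>\<^sub>g G) \<longleftrightarrow>
      (\<exists>Y \<in> fset (right_opts H). \<not> right_wins_first (game_neg Y \<oplus>\<^sub>g G)) \<or>
      (\<exists>X \<in> fset (left_opts G). \<not> right_wins_first (game_neg H \<oplus>\<^sub>g X))"
    by (subst left_wins_first.simps) (auto simp: left_opts_sum neg_opts)
  also have "\<dots> \<longleftrightarrow> (\<exists>Y \<in> fset (right_opts H). Y \<le>\<^sub>g G) \<or> (\<exists>X \<in> fset (left_opts G). H \<le>\<^sub>g X)"
    using less.hyps by (meson add_less_mono1 add_less_mono nat_add_left_cancel_less
        size_left_option size_right_option)
  also have "\<dots> \<longleftrightarrow> \<not> G \<le>\<^sub>g H" by (subst game_le.simps) blast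
  finally have 1: "left_wins_first (game_neg H \<oplus>\<^sub>g G) \<longleftrightarrow> \<not> G \<le>\<^sub>g H" .
  have "right_wins_first (game_neg H \<oplus>\<^sub>g G) \<longleftrightarrow>
      (\<exists>Y \<in> fset (left_opts H). \<not> left_wins_first (game_neg Y \<oplus>\<^sub>g G)) \<or>
      (\<exists>X \<in> fset (right_opts G). \<not> left_wins_first (game_neg H \<oplus>\<^sub>g X))"
    by (subst right_wins_first.simps) (auto simp: right_opts_sum neg_opts)
  also have "\<dots> \<longleftrightarrow> (\<exists>Y \<in> fset (left_opts H). G \<le>\<^sub>g Y) \<or> (\<exists>X \<in> fset (right_opts G). X \<le>\<^sub>g H)"
    using less.hyps by (meson add_less_mono1 add_less_mono nat_add_left_cancel_less
        size_left_option size_right_option)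
  also have "\<dots> \<longleftrightarrow> \<not> H \<le>\<^sub>g G" by (subst game_le.simps) blast
  finally show ?case using 1 by blast
qed

text \<open>Add the negative of \<open>K\<close>: a win for Left moving first with \<open>G\<close>
  would carry over to \<open>H\<close> by \<open>game_le_sum\<close>.\<close>

lemma game_le_trans [trans]: "G \<le>\<^sub>g H \<Longrightarrow> H \<le>\<^sub>g K \<Longrightarrow> G \<le>\<^sub>g K"
  using game_le_sum[of G H "game_neg K"] neg_sum_outcome by blast

lemma not_left_opt_ge: "X \<in> fset (left_opts G) \<Longrightarrow> \<not> G \<le>\<^sub>g X"
  using game_le_left game_le_refl by blast

lemma not_right_opt_le: "Y \<in> fset (right_opts G) \<Longrightarrow> \<not> Y \<le>\<^sub>g G"
  using game_le_right game_le_refl by blast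

lemma game_eq_iff_le: "G \<simeq> H \<longleftrightarrow> G \<le>\<^sub>g H \<and> H \<le>\<^sub>g G"
proof
  assume "G \<simeq> H"
  then have "outcome (game_neg H \<oplus>\<^sub>g G) = outcome (game_neg H \<oplus>\<^sub>g H)"
    by (auto simp: game_eq_def)
  moreover have "outcome (game_neg H \<oplus>\<^sub>g H) = Previous_Wins"
    using neg_sum_outcome[of H H] by (simp add: outcome_def)
  ultimately show "G \<le>\<^sub>g H \<and> H \<le>\<^sub>g G"
    using neg_sum_outcome[of H G] by (auto simp: outcome_def split: if_splits)
next
  assume "G \<le>\<^sub>g H \<and> H \<le>\<^sub>g G"
  then show "G \<simeq> H"
    using game_le_sum[of G H] game_le_sum[of H G] unfolding game_eq_def outcome_def by auto
qed

section \<open>Placement games and integers\<close>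

text \<open>Colours and out-neighbours are fixed once and a position is only the set of remaining
  vertices, so that positions can be compared by inclusion and their vertices counted.\<close>

function digraph_game :: "('v \<Rightarrow> colour) \<Rightarrow> ('v \<Rightarrow> 'v set) \<Rightarrow> 'v set \<Rightarrow> game" where
  "digraph_game c N S =
     (if finite S then
        Game (Abs_fset ((\<lambda>v. digraph_game c N (S - insert v (N v))) ` {v \<in> S. c v = Blue}))
             (Abs_fset ((\<lambda>v. digraph_game c N (S - insert v (N v))) ` {v \<in> S. c v = Red}))
      else Game {||} {||})"
  by pat_completeness auto
termination
  by (relation "measure (\<lambda>(c, N, S). card S)") (auto intro!: psubset_card_mono)

declare digraph_game.simps [simp del]

lemma digraph_game_opts:
  assumes "finite S"
  shows "fset (left_opts (digraph_game c N S)) =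
           (\<lambda>v. digraph_game c N (S - insert v (N v))) ` {v \<in> S. c v = Blue}"
    and "fset (right_opts (digraph_game c N S)) =
           (\<lambda>v. digraph_game c N (S - insert v (N v))) ` {v \<in> S. c v = Red}"
  using assms by (subst digraph_game.simps; simp add: Abs_fset_inverse)+

lemma game_eqI:
  "fset (left_opts G) = fset (left_opts H) \<Longrightarrow> fset (right_opts G) = fset (right_opts H) \<Longrightarrow> G = H"
  by (simp add: fset_inject game.expand)

text \<open>Loops are left unconstrained, since the chosen vertex is deleted in any case.\<close>

lemma placement_game_eq_digraph_game:
  assumes "finite (verts D)"
    and "\<And>v u. v \<in> verts D \<Longrightarrow> u \<in> verts D \<Longrightarrow> u \<noteq> v \<Longrightarrow> v \<rightarrow>\<^bsub>D\<^esub> u \<longleftrightarrow> u \<in> N v"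
  shows "placement_game c D = digraph_game c N (verts D)"
  using assms
proof (induction "card (verts D)" arbitrary: D rule: less_induct)
  case less
  have step: "placement_game c (place D v) = digraph_game c N (verts D - insert v (N v))"
    if v: "v \<in> verts D" for v
  proof -
    have verts: "verts (place D v) = verts D - insert v (N v)"
      using less.prems(2)[OF v] by (auto simp: place_def)
    have "w \<rightarrow>\<^bsub>place D v\<^esub> u \<longleftrightarrow> w \<rightarrow>\<^bsub>D\<^esub> u"
      if "w \<in> verts (place D v)" "u \<in> verts (place D v)" for w u
      using that unfolding place_def arcs_ends_def arc_to_ends_def by auto
    then have "placement_game c (place D v) = digraph_game c N (verts (place D v))"
      using less.prems v card_verts_place[OF less.prems(1) v]
      by (intro less.hyps) (auto simp: verts finite_verts_place)
    then show ?thesis by (simp add: verts)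
  qed
  show ?case
    using less.prems(1) step
    by (intro game_eqI) (auto simp: placement_game_opts digraph_game_opts intro!: image_cong)
qed

lemma digraph_game_relabel:
  assumes "finite S" "inj_on f S"
    and "\<And>v. v \<in> S \<Longrightarrow> c' (f v) = c v"
    and "\<And>u v. u \<in> S \<Longrightarrow> v \<in> S \<Longrightarrow> u \<noteq> v \<Longrightarrow> f v \<in> N' (f u) \<longleftrightarrow> v \<in> N u"
  shows "digraph_game c' N' (f ` S) = digraph_game c N S"
  using assms
proof (induction "card S" arbitrary: S rule: less_induct)
  case less
  have step: "digraph_game c' N' (f ` S - insert (f v) (N' (f v))) = digraph_game c N (S - insert v (N v))"
    if v: "v \<in> S" for v
  proof -
    have "f ` S - insert (f v) (N' (f v)) = f ` (S - insert v (N v))"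
      using v less.prems(4)[OF v] inj_onD[OF less.prems(2)] by auto
    moreover have "digraph_game c' N' (f ` (S - insert v (N v))) = digraph_game c N (S - insert v (N v))"
    proof (rule less.hyps)
      show "card (S - insert v (N v)) < card S"
        using v less.prems(1) by (intro psubset_card_mono) auto
      show "inj_on f (S - insert v (N v))" using less.prems(2) by (rule inj_on_subset) auto
    qed (use less.prems in auto)
    ultimately show ?thesis by simp
  qed
  have "{v \<in> f ` S. c' v = col} = f ` {v \<in> S. c v = col}" for col
    using less.prems(3) by auto
  then show ?case
    using less.prems(1) step by (intro game_eqI) (auto simp: digraph_game_opts image_image intro!: image_cong)
qed

text \<open>Additional blue vertices and missing red ones can only favour Left. The same vertex is
  played in both positions, and deleting the same set from both preserves the two
  inclusions.\<close>

lemma digraph_game_mono: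
  assumes "finite S" "finite T"
    and "{v \<in> T. c v = Blue} \<subseteq> S" "{v \<in> S. c v = Red} \<subseteq> T"
  shows "digraph_game c N T \<le>\<^sub>g digraph_game c N S"
  using assms
proof (induction "card S + card T" arbitrary: S T rule: less_induct)
  case less
  have smaller: "card (U - insert v (N v)) < card U" if "v \<in> U" "finite U" for v U
    using that by (intro psubset_card_mono) auto
  show ?case
  proof (rule game_leI)
    fix X assume "X \<in> fset (left_opts (digraph_game c N T))"
    then obtain v where v: "v \<in> T" "c v = Blue" "X = digraph_game c N (T - insert v (N v))"
      using less.prems(2) by (auto simp: digraph_game_opts)
    then have "v \<in> S" using less.prems(3) by auto
    then have "digraph_game c N (S - insert v (N v)) \<in> fset (left_opts (digraph_game c N S))"
      using v less.prems(1) by (auto simp: digraph_game_opts)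
    then have "\<not> digraph_game c N S \<le>\<^sub>g digraph_game c N (S - insert v (N v))"
      by (rule not_left_opt_ge)
    moreover have "X \<le>\<^sub>g digraph_game c N (S - insert v (N v))"
      unfolding v(3)
      using less.prems smaller[OF v(1) less.prems(2)] smaller[OF \<open>v \<in> S\<close> less.prems(1)]
      by (intro less.hyps) auto
    ultimately show "\<not> digraph_game c N S \<le>\<^sub>g X" using game_le_trans by blast
  next
    fix Y assume "Y \<in> fset (right_opts (digraph_game c N S))"
    then obtain v where v: "v \<in> S" "c v = Red" "Y = digraph_game c N (S - insert v (N v))"
      using less.prems(1) by (auto simp: digraph_game_opts)
    then have "v \<in> T" using less.prems(4) by auto
    then have "digraph_game c N (T - insert v (N v)) \<in> fset (right_opts (digraph_game c N T))"
      using v less.prems(2) by (auto simp: digraph_game_opts)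
    then have "\<not> digraph_game c N (T - insert v (N v)) \<le>\<^sub>g digraph_game c N T"
      by (rule not_right_opt_le)
    moreover have "digraph_game c N (T - insert v (N v)) \<le>\<^sub>g Y"
      unfolding v(3)
      using less.prems smaller[OF v(1) less.prems(1)] smaller[OF \<open>v \<in> T\<close> less.prems(2)]
      by (intro less.hyps) auto
    ultimately show "\<not> Y \<le>\<^sub>g digraph_game c N T" using game_le_trans by blast
  qed
qed

section \<open>Integers as games\<close>

fun pos_int :: "nat \<Rightarrow> game" where
  "pos_int 0 = Game {||} {||}"
| "pos_int (Suc k) = Game {|pos_int k|} {||}"

fun neg_int :: "nat \<Rightarrow> game" where
  "neg_int 0 = Game {||} {||}"
| "neg_int (Suc k) = Game {||} {|neg_int k|}"

lemma left_opts_neg_int [simp]: "left_opts (neg_int k) = {||}"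
  by (cases k) auto

lemma right_opts_pos_int [simp]: "right_opts (pos_int k) = {||}"
  by (cases k) auto

lemma neg_int_le:
  "birthday G \<le> k \<Longrightarrow> neg_int k \<le>\<^sub>g G"
proof (induction k arbitrary: G)
  case 0
  then have "(move ^^ n) G X \<Longrightarrow> n = 0" for n X using birthday_le_iff[of G 0] by blast
  then have "\<not> move G X" for X by (metis relpowp_1 zero_neq_one)
  then show ?case by (auto simp: move_def intro!: game_leI)
next
  case (Suc k)
  show ?case
  proof (rule game_leI)
    fix Y assume Y: "Y \<in> fset (right_opts G)"
    then have "neg_int k \<le>\<^sub>g Y"
      using Suc birthday_option by (auto simp: move_def)
    then show "\<not> Y \<le>\<^sub>g neg_int (Suc k)"
      using game_le_right[of Y "neg_int (Suc k)" "neg_int k"] by auto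
  qed simp
qed

lemma le_pos_int:
  "birthday G \<le> k \<Longrightarrow> G \<le>\<^sub>g pos_int k"
proof (induction k arbitrary: G)
  case 0
  then have "(move ^^ n) G X \<Longrightarrow> n = 0" for n X using birthday_le_iff[of G 0] by blast
  then have "\<not> move G X" for X by (metis relpowp_1 zero_neq_one)
  then show ?case by (auto simp: move_def intro!: game_leI)
next
  case (Suc k)
  show ?case
  proof (rule game_leI)
    fix Y assume Y: "Y \<in> fset (left_opts G)"
    then have "Y \<le>\<^sub>g pos_int k"
      using Suc birthday_option by (auto simp: move_def)
    then show "\<not> pos_int (Suc k) \<le>\<^sub>g Y"
      using game_le_left[of "pos_int (Suc k)" Y "pos_int k"] by auto
  qed simp
qed

text \<open>Without arcs each Right move costs exactly one vertex, so the position is in fact worth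
  \<open>-k\<close>; the upper bound is the half that the guards call for.\<close>

lemma independent_red_le:
  assumes "finite S" "\<And>v. v \<in> S \<Longrightarrow> c v = Red" "\<And>u v. u \<in> S \<Longrightarrow> v \<in> S \<Longrightarrow> v \<notin> N u"
    and "card S = k"
  shows "digraph_game c N S \<le>\<^sub>g neg_int k"
  using assms
proof (induction k arbitrary: S)
  case 0
  then show ?case by (auto simp: digraph_game_opts intro!: game_leI)
next
  case (Suc k)
  then obtain v where v: "v \<in> S" by fastforce
  have "digraph_game c N (S - insert v (N v)) \<in> fset (right_opts (digraph_game c N S))"
    using v Suc.prems by (auto simp: digraph_game_opts)
  moreover have "digraph_game c N (S - insert v (N v)) \<le>\<^sub>g neg_int k"
  proof -
    have "S - insert v (N v) = S - {v}" using Suc.prems v by auto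
    then show ?thesis using Suc.prems v by (intro Suc.IH) auto
  qed
  ultimately have "\<not> neg_int k \<le>\<^sub>g digraph_game c N S"
    using not_right_opt_le game_le_trans by blast
  moreover have "fset (left_opts (digraph_game c N S)) = {}"
    using Suc.prems by (auto simp: digraph_game_opts)
  ultimately show ?case by (intro game_leI) auto
qed

lemma independent_blue_ge:
  assumes "finite S" "\<And>v. v \<in> S \<Longrightarrow> c v = Blue" "\<And>u v. u \<in> S \<Longrightarrow> v \<in> S \<Longrightarrow> v \<notin> N u"
    and "card S = k"
  shows "pos_int k \<le>\<^sub>g digraph_game c N S"
  using assms
proof (induction k arbitrary: S)
  case 0
  then show ?case by (auto simp: digraph_game_opts intro!: game_leI)
next
  case (Suc k)
  then obtain v where v: "v \<in> S" by fastforce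
  have "digraph_game c N (S - insert v (N v)) \<in> fset (left_opts (digraph_game c N S))"
    using v Suc.prems by (auto simp: digraph_game_opts)
  moreover have "pos_int k \<le>\<^sub>g digraph_game c N (S - insert v (N v))"
  proof -
    have "S - insert v (N v) = S - {v}" using Suc.prems v by auto
    then show ?thesis using Suc.prems v by (intro Suc.IH) auto
  qed
  ultimately have "\<not> digraph_game c N S \<le>\<^sub>g pos_int k"
    using not_left_opt_ge game_le_trans by blast
  moreover have "fset (right_opts (digraph_game c N S)) = {}"
    using Suc.prems by (auto simp: digraph_game_opts)
  ultimately show ?case by (intro game_leI) auto
qed

section \<open>Universality\<close>

datatype vertex = Opt colour game | Inner game nat | Guard nat nat

primrec vertex_colour :: "(game \<Rightarrow> nat \<Rightarrow> colour) \<Rightarrow> vertex \<Rightarrow> colour" where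
  "vertex_colour c (Opt k X) = k"
| "vertex_colour c (Inner X n) = c X n"
| "vertex_colour c (Guard i j) = (if even i then Red else Blue)"

text \<open>The out-neighbours of a vertex are those not kept. \<open>Opt k X\<close> is the intended move to the
  option \<open>X\<close>, represented by the vertices \<open>Inner X n\<close>. Every other move is unintended, and a large
  class of guards of the opposite colour survives it: a reply in that class destroys everything else
  and leaves a very bad number for the player who made it. The four guard classes are arranged in
  a cycle of alternating colours, so that a move in one class is punished in the next one.\<close>

primrec kept :: "(game \<Rightarrow> nat \<Rightarrow> colour) \<Rightarrow> (game \<Rightarrow> nat \<Rightarrow> nat set) \<Rightarrow> vertex \<Rightarrow> vertex set" where
  "kept c N (Opt k X) = range (Inner X)"
| "kept c N (Inner X n) =
     Inner X ` (- N X n) \<union> range (Guard (if c X n = Blue then 0 else 1))"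
| "kept c N (Guard i j) = range (Guard i) \<union> range (Guard (Suc i mod 4))"

text \<open>A guard class has \<open>birthday G + 1\<close> members: one is spent on the reply, and
  the other \<open>birthday G\<close> form an integer that bounds \<open>G\<close>.\<close>

definition vertices :: "(game \<Rightarrow> nat set) \<Rightarrow> game \<Rightarrow> vertex set" where
  "vertices S G =
     Opt Blue ` fset (left_opts G) \<union> Opt Red ` fset (right_opts G)
     \<union> (\<Union>X \<in> fset (left_opts G) \<union> fset (right_opts G). Inner X ` S X)
     \<union> (\<Union>i<4. Guard i ` {..birthday G})"

text \<open>The reply \<open>Guard i 0\<close> spares only class \<open>i\<close> and the next class
  modulo 4. The latter is empty, so \<open>k\<close> guards of one colour without arcs remain, and
  that integer bounds every game born by day \<open>k\<close>.\<close>

lemma guard_reply: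
  assumes T: "finite T" "Guard i ` {..k} \<subseteq> T" "T \<inter> range (Guard i) \<subseteq> Guard i ` {..k}"
      "T \<inter> range (Guard (Suc i mod 4)) = {}"
    and k: "birthday G \<le> k"
  shows "even i \<Longrightarrow> \<not> G \<le>\<^sub>g digraph_game (vertex_colour c) (\<lambda>v. - kept c N v) T"
    and "odd i \<Longrightarrow> \<not> digraph_game (vertex_colour c) (\<lambda>v. - kept c N v) T \<le>\<^sub>g G"
proof -
  let ?g = "digraph_game (vertex_colour c) (\<lambda>v. - kept c N v)"
  let ?u = "Guard i 0"
  let ?T' = "T - insert ?u (- kept c N ?u)"
  have T': "?T' = Guard i ` {1..k}"
  proof
    show "?T' \<subseteq> Guard i ` {1..k}"
    proof
      fix x assume x: "x \<in> ?T'"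
      then have "x \<in> T \<inter> range (Guard i)" using T(4) by auto
      then obtain j where "x = Guard i j" "j \<le> k" using T(3) by auto
      with x show "x \<in> Guard i ` {1..k}" by (cases j) auto
    qed
  qed (use T(2) in auto)
  have u: "?u \<in> T" using T(2) by auto
  have card: "card (Guard i ` {1..k}) = k"
    by (subst card_image) (auto simp: inj_on_def)
  show "\<not> G \<le>\<^sub>g ?g T" if i: "even i"
  proof -
    have "?g ?T' \<le>\<^sub>g neg_int k"
      unfolding T' using i card by (intro independent_red_le) auto
    also have "neg_int k \<le>\<^sub>g G" using k by (rule neg_int_le)
    finally have "?g ?T' \<le>\<^sub>g G" .
    moreover have "?g ?T' \<in> fset (right_opts (?g T))"
      unfolding digraph_game_opts[OF T(1)] using u i by (intro image_eqI[of _ _ ?u]) auto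
    ultimately show ?thesis using game_le_right by blast
  qed
  show "\<not> ?g T \<le>\<^sub>g G" if i: "odd i"
  proof -
    have "G \<le>\<^sub>g pos_int k" using k by (rule le_pos_int)
    also have "pos_int k \<le>\<^sub>g ?g ?T'"
      unfolding T' using i card by (intro independent_blue_ge) auto
    finally have "G \<le>\<^sub>g ?g ?T'" .
    moreover have "?g ?T' \<in> fset (left_opts (?g T))"
      unfolding digraph_game_opts[OF T(1)] using u i by (intro image_eqI[of _ _ ?u]) auto
    ultimately show ?thesis using game_le_left by blast
  qed
qed

lemma vertices_game_eq:
  assumes rep: "\<And>X. X \<in> fset (left_opts G) \<union> fset (right_opts G) \<Longrightarrow>
      finite (S X) \<and> digraph_game (c X) (N X) (S X) \<simeq> X"
  shows "digraph_game (vertex_colour c) (\<lambda>v. - kept c N v) (vertices S G) \<simeq> G"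
proof -
  let ?g = "digraph_game (vertex_colour c) (\<lambda>v. - kept c N v)"
  let ?V = "vertices S G"
  let ?after = "\<lambda>v. ?V - insert v (- kept c N v)"
  have fin: "finite ?V" using rep by (auto simp: vertices_def)
  then have fin': "finite (?after v)" for v by simp
  have opt: "?g (?after (Opt k X)) \<simeq> X"
    if X: "X \<in> fset (left_opts G) \<union> fset (right_opts G)" for k X
  proof -
    have "?after (Opt k X) = Inner X ` S X" using X by (auto simp: vertices_def)
    moreover have "?g (Inner X ` S X) = digraph_game (c X) (N X) (S X)"
      using rep[OF X] by (intro digraph_game_relabel) (auto simp: inj_on_def)
    ultimately show ?thesis using rep[OF X] by simp
  qed
  have Guard_mem: "Guard i j \<in> ?V \<longleftrightarrow> i < 4 \<and> j \<le> birthday G" for i j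
    by (auto simp: vertices_def)
  have guards: "Guard i ` {..birthday G} \<subseteq> ?after v"
      "?after v \<inter> range (Guard i) \<subseteq> Guard i ` {..birthday G}"
      "?after v \<inter> range (Guard (Suc i mod 4)) = {}"
    if "i < 4" "range (Guard i) \<subseteq> kept c N v" "range (Guard (Suc i mod 4)) \<inter> kept c N v = {}"
      "v \<notin> range (Guard i)" for i v
    using that Guard_mem by blast+
  have refuted: "\<not> G \<le>\<^sub>g ?g (?after v)"
    if v: "v \<in> ?V" "vertex_colour c v = Blue" "\<And>k X. v \<noteq> Opt k X" for v
  proof -
    \<comment> \<open>A blue inner vertex spares class 0 and deletes class 1. A guard of class
      \<open>l\<close> spares class \<open>l + 1\<close> and deletes class \<open>l + 2\<close>; as
      there are four classes, the latter is not its own class, which it spares.\<close>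
    have "\<exists>i. even i \<and> i < 4 \<and> range (Guard i) \<subseteq> kept c N v \<and>
      range (Guard (Suc i mod 4)) \<inter> kept c N v = {} \<and> v \<notin> range (Guard i)"
    proof (cases v)
      case (Inner X n)
      with v(2) show ?thesis by (intro exI[of _ 0]) auto
    next
      case (Guard l j)
      with v(1,2) have "odd l" "l < 4" by (auto simp: Guard_mem split: if_splits)
      then have "l = 1 \<or> l = 3" by presburger
      with Guard show ?thesis by (intro exI[of _ "Suc l mod 4"]) auto
    qed (use v(3) in blast)
    then obtain i where i: "even i" "i < 4" "range (Guard i) \<subseteq> kept c N v"
        "range (Guard (Suc i mod 4)) \<inter> kept c N v = {}" "v \<notin> range (Guard i)"
      by blast
    show ?thesis by (rule guard_reply(1)[OF fin' guards[OF i(2-)] order_refl i(1)])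
  qed
  have refuted': "\<not> ?g (?after v) \<le>\<^sub>g G"
    if v: "v \<in> ?V" "vertex_colour c v = Red" "\<And>k X. v \<noteq> Opt k X" for v
  proof -
    have "\<exists>i. odd i \<and> i < 4 \<and> range (Guard i) \<subseteq> kept c N v \<and>
      range (Guard (Suc i mod 4)) \<inter> kept c N v = {} \<and> v \<notin> range (Guard i)"
    proof (cases v)
      case (Inner X n)
      with v(2) show ?thesis by (intro exI[of _ 1]) auto
    next
      case (Guard l j)
      with v(1,2) have "even l" "l < 4" by (auto simp: Guard_mem split: if_splits)
      then have "l = 0 \<or> l = 2" by presburger
      with Guard show ?thesis by (intro exI[of _ "Suc l"]) (auto; presburger)
    qed (use v(3) in blast)
    then obtain i where i: "odd i" "i < 4" "range (Guard i) \<subseteq> kept c N v"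
        "range (Guard (Suc i mod 4)) \<inter> kept c N v = {}" "v \<notin> range (Guard i)"
      by blast
    show ?thesis by (rule guard_reply(2)[OF fin' guards[OF i(2-)] order_refl i(1)])
  qed
  have left: "\<exists>v\<in>?V. vertex_colour c v = Blue \<and> X \<le>\<^sub>g ?g (?after v)" if "X \<in> fset (left_opts G)" for X
    using that opt[of X Blue] by (intro bexI[of _ "Opt Blue X"]) (auto simp: vertices_def game_eq_iff_le)
  have right: "\<exists>v\<in>?V. vertex_colour c v = Red \<and> ?g (?after v) \<le>\<^sub>g X" if "X \<in> fset (right_opts G)" for X
    using that opt[of X Red] by (intro bexI[of _ "Opt Red X"]) (auto simp: vertices_def game_eq_iff_le)
  have "?g ?V \<le>\<^sub>g G"
  proof (rule game_leI)
    fix X assume "X \<in> fset (left_opts (?g ?V))"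
    then obtain v where v: "v \<in> ?V" "vertex_colour c v = Blue" "X = ?g (?after v)"
      using fin by (auto simp: digraph_game_opts)
    show "\<not> G \<le>\<^sub>g X"
    proof (cases "\<exists>k Y. v = Opt k Y")
      case True
      then obtain Y where Y: "v = Opt Blue Y" "Y \<in> fset (left_opts G)"
        using v by (auto simp: vertices_def)
      then have "X \<le>\<^sub>g Y" using opt v by (auto simp: game_eq_iff_le)
      with Y show ?thesis using not_left_opt_ge game_le_trans by blast
    qed (use v refuted in blast)
  next
    fix Y assume "Y \<in> fset (right_opts G)"
    then obtain v where v: "v \<in> ?V" "vertex_colour c v = Red" "?g (?after v) \<le>\<^sub>g Y"
      using right by blast
    then have "?g (?after v) \<in> fset (right_opts (?g ?V))"
      using fin by (auto simp: digraph_game_opts)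
    then show "\<not> Y \<le>\<^sub>g ?g ?V" using v(3) not_right_opt_le game_le_trans by blast
  qed
  moreover have "G \<le>\<^sub>g ?g ?V"
  proof (rule game_leI)
    fix X assume "X \<in> fset (right_opts (?g ?V))"
    then obtain v where v: "v \<in> ?V" "vertex_colour c v = Red" "X = ?g (?after v)"
      using fin by (auto simp: digraph_game_opts)
    show "\<not> X \<le>\<^sub>g G"
    proof (cases "\<exists>k Y. v = Opt k Y")
      case True
      then obtain Y where Y: "v = Opt Red Y" "Y \<in> fset (right_opts G)"
        using v by (auto simp: vertices_def)
      then have "Y \<le>\<^sub>g X" using opt v by (auto simp: game_eq_iff_le)
      with Y show ?thesis using not_right_opt_le game_le_trans by blast
    qed (use v refuted' in blast)
  next
    fix Y assume "Y \<in> fset (left_opts G)"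
    then obtain v where v: "v \<in> ?V" "vertex_colour c v = Blue" "Y \<le>\<^sub>g ?g (?after v)"
      using left by blast
    then have "?g (?after v) \<in> fset (left_opts (?g ?V))"
      using fin by (auto simp: digraph_game_opts)
    then show "\<not> ?g ?V \<le>\<^sub>g Y" using v(3) not_left_opt_ge game_le_trans by blast
  qed
  ultimately show ?thesis by (simp add: game_eq_iff_le)
qed

text \<open>\<open>Inner\<close> names the vertices of an option by naturals, so each induction step
  ends by renaming the new vertices injectively to naturals.\<close>

lemma digraph_game_universal:
  "\<exists>c N (S :: nat set). finite S \<and> digraph_game c N S \<simeq> G"
proof (induction "size G" arbitrary: G rule: less_induct)
  case less
  have "\<forall>X \<in> fset (left_opts G) \<union> fset (right_opts G).
      \<exists>c N (S :: nat set). finite S \<and> digraph_game c N S \<simeq> X"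
    using less size_left_option size_right_option by blast
  from bchoice[OF this] obtain c where
    "\<forall>X \<in> fset (left_opts G) \<union> fset (right_opts G).
      \<exists>N (S :: nat set). finite S \<and> digraph_game (c X) N S \<simeq> X"
    by blast
  from bchoice[OF this] obtain N where
    "\<forall>X \<in> fset (left_opts G) \<union> fset (right_opts G).
      \<exists>S :: nat set. finite S \<and> digraph_game (c X) (N X) S \<simeq> X"
    by blast
  from bchoice[OF this] obtain S :: "game \<Rightarrow> nat set" where rep:
    "\<And>X. X \<in> fset (left_opts G) \<union> fset (right_opts G) \<Longrightarrow>
      finite (S X) \<and> digraph_game (c X) (N X) (S X) \<simeq> X"
    by blast
  have fin: "finite (vertices S G)" using rep by (auto simp: vertices_def)
  obtain f :: "vertex \<Rightarrow> nat" where f: "inj_on f (vertices S G)"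
    using finite_imp_inj_to_nat_seg[OF fin] by blast
  let ?h = "the_inv_into (vertices S G) f"
  have relabel: "digraph_game (\<lambda>n. vertex_colour c (?h n)) (\<lambda>n. {m. ?h m \<notin> kept c N (?h n)}) (f ` vertices S G) =
      digraph_game (vertex_colour c) (\<lambda>v. - kept c N v) (vertices S G)"
    using f by (intro digraph_game_relabel fin) (auto simp: the_inv_into_f_f)
  have "digraph_game (vertex_colour c) (\<lambda>v. - kept c N v) (vertices S G) \<simeq> G"
    by (rule vertices_game_eq[OF rep])
  then show ?case using fin by (subst (asm) relabel[symmetric]) blast
qed

lemma ex_digraph:
  fixes S :: "nat set"
  assumes "finite S"
  shows "\<exists>D :: (nat, nat \<times> nat) pre_digraph. digraph D \<and> verts D = S \<and> placement_game c D = digraph_game c N S"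
proof -
  \<comment> \<open>\<open>digraph\<close> admits neither loops nor parallel arcs. Dropping loops
    changes no move, and pairs as arcs exclude parallel ones.\<close>
  define D :: "(nat, nat \<times> nat) pre_digraph" where
    "D = \<lparr>verts = S, arcs = {(u, v). u \<in> S \<and> v \<in> S \<and> u \<noteq> v \<and> v \<in> N u}, tail = fst, head = snd\<rparr>"
  have fin: "finite (arcs D)"
    by (rule finite_subset[of _ "S \<times> S"]) (auto simp: D_def assms)
  have "digraph D"
  proof
    show "finite (arcs D)" by (rule fin)
  qed (auto simp: D_def assms arc_to_ends_def)
  moreover have "placement_game c D = digraph_game c N (verts D)"
  proof (rule placement_game_eq_digraph_game)
    show "finite (verts D)" by (simp add: D_def assms)
    show "v \<rightarrow>\<^bsub>D\<^esub> u \<longleftrightarrow> u \<in> N v" if "v \<in> verts D" "u \<in> verts D" "u \<noteq> v" for u v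
      using that by (force simp: D_def arcs_ends_def arc_to_ends_def)
  qed
  ultimately show ?thesis by (intro exI[of _ D]) (simp add: D_def)
qed

lemma placement_size_attained:
  obtains c N and S :: "nat set" where
    "finite S" "card S = placement_size (value_of G)" "digraph_game c N S \<simeq> G"
proof -
  let ?P = "\<lambda>n. \<exists>(D :: (nat, nat \<times> nat) pre_digraph) c.
        digraph D \<and> card (verts D) = n \<and> value_of (placement_game c D) = value_of G"
  have "\<exists>n. ?P n"
    using digraph_game_universal[of G] ex_digraph by (metis value_of_eq_iff)
  then have "?P (placement_size (value_of G))"
    unfolding placement_size_def by (rule LeastI_ex)
  then obtain D :: "(nat, nat \<times> nat) pre_digraph" and c where
    D: "digraph D" "card (verts D) = placement_size (value_of G)" "placement_game c D \<simeq> G"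
    by (auto simp: value_of_eq_iff)
  then have "finite (verts D)" by (simp add: digraph.axioms(1) fin_digraph.finite_verts)
  then have "placement_game c D = digraph_game c (\<lambda>v. {u. v \<rightarrow>\<^bsub>D\<^esub> u}) (verts D)"
    by (intro placement_game_eq_digraph_game) auto
  with D \<open>finite (verts D)\<close> show ?thesis using that by metis
qed

lemma placement_size_le_max:
  "birthday G \<le> b \<Longrightarrow> placement_size (value_of G) \<le> max_placement_size b"
  unfolding max_placement_size_def values_born_by_def
  using finite_values_born_by[of b] by (intro Max_ge) (auto simp: values_born_by_def)

section \<open>Reversible options of a placement game\<close>

abbreviation blues :: "('v \<Rightarrow> colour) \<Rightarrow> 'v set \<Rightarrow> 'v set" where
  "blues c S \<equiv> {v \<in> S. c v = Blue}"

abbreviation reds :: "('v \<Rightarrow> colour) \<Rightarrow> 'v set \<Rightarrow> 'v set" where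
  "reds c S \<equiv> {v \<in> S. c v = Red}"

lemma card_blues_reds: "finite S \<Longrightarrow> card (blues c S) + card (reds c S) = card S"
proof -
  assume "finite S"
  then have "card (blues c S \<union> reds c S) = card (blues c S) + card (reds c S)"
    by (intro card_Un_disjoint) auto
  moreover have "blues c S \<union> reds c S = S" using colour.exhaust by blast
  ultimately show ?thesis by simp
qed

lemma card_colour_delete_less:
  assumes "finite S" "v \<in> S" "c v = k"
  shows "card {u \<in> S - insert v M. c u = k} < card {u \<in> S. c u = k}"
proof (rule psubset_card_mono)
  have "v \<in> {u \<in> S. c u = k}" "v \<notin> {u \<in> S - insert v M. c u = k}" using assms by auto
  then show "{u \<in> S - insert v M. c u = k} \<subset> {u \<in> S. c u = k}" by blast
qed (use assms in simp)

text \<open>For positive \<open>k\<close>, a position below \<open>-k\<close> has a Right move to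
  one below \<open>-(k - 1)\<close>; each of these \<open>k\<close> moves uses up a red
  vertex.\<close>

lemma le_neg_int_card_reds:
  "finite S \<Longrightarrow> digraph_game c N S \<le>\<^sub>g neg_int k \<Longrightarrow> k \<le> card (reds c S)"
proof (induction k arbitrary: S)
  case (Suc k)
  have "\<not> neg_int k \<le>\<^sub>g digraph_game c N S"
    using Suc.prems game_le_right[of _ "neg_int (Suc k)" "neg_int k"] by auto
  then obtain w where w: "w \<in> reds c S" "digraph_game c N (S - insert w (N w)) \<le>\<^sub>g neg_int k"
    using Suc.prems by (auto simp: digraph_game_opts elim!: not_game_leE)
  have "k \<le> card (reds c (S - insert w (N w)))"
    using Suc.prems(1) by (intro Suc.IH[OF _ w(2)]) simp
  also have "\<dots> < card (reds c S)" using w Suc.prems by (intro card_colour_delete_less) auto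
  finally show ?case by simp
qed auto

lemma pos_int_le_card_blues:
  "finite S \<Longrightarrow> pos_int k \<le>\<^sub>g digraph_game c N S \<Longrightarrow> k \<le> card (blues c S)"
proof (induction k arbitrary: S)
  case (Suc k)
  have "\<not> digraph_game c N S \<le>\<^sub>g pos_int k"
    using Suc.prems game_le_left[of "pos_int (Suc k)" _ "pos_int k"] by auto
  then obtain w where w: "w \<in> blues c S" "pos_int k \<le>\<^sub>g digraph_game c N (S - insert w (N w))"
    using Suc.prems by (auto simp: digraph_game_opts elim!: not_game_leE)
  have "k \<le> card (blues c (S - insert w (N w)))"
    using Suc.prems(1) by (intro Suc.IH[OF _ w(2)]) simp
  also have "\<dots> < card (blues c S)" using w Suc.prems by (intro card_colour_delete_less) auto
  finally show ?case by simp
qed auto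

text \<open>The Right option \<open>neg_int b\<close> lies below every game of birthday at most \<open>b\<close>, so that no option in
  \<open>A\<close> is reversible.\<close>

definition hot :: "game fset \<Rightarrow> nat \<Rightarrow> game" where
  "hot A b = Game A {|neg_int b|}"

lemma le_hot: "Y \<le>\<^sub>g hot A b \<Longrightarrow> \<not> neg_int b \<le>\<^sub>g Y"
  using game_le_right[of Y "hot A b" "neg_int b"] by (simp add: hot_def)

text \<open>Right must be able to match the option \<open>-b\<close>: one red vertex for that move
  and \<open>b\<close> more for the integer.\<close>

lemma le_hot_card_reds:
  assumes "finite S" "digraph_game c N S \<le>\<^sub>g hot A b"
  shows "b < card (reds c S)"
proof -
  have "\<not> neg_int b \<le>\<^sub>g digraph_game c N S" using assms by (intro le_hot)
  then obtain w where w: "w \<in> reds c S" "digraph_game c N (S - insert w (N w)) \<le>\<^sub>g neg_int b"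
    using assms(1) by (auto simp: digraph_game_opts elim!: not_game_leE)
  then have "b \<le> card (reds c (S - insert w (N w)))"
    using assms(1) le_neg_int_card_reds by blast
  also have "\<dots> < card (reds c S)" using w assms(1) by (intro card_colour_delete_less) auto
  finally show ?thesis .
qed

lemma birthday_right: "Y \<in> fset (right_opts G) \<Longrightarrow> birthday G \<le> b \<Longrightarrow> birthday Y \<le> b"
  using birthday_option[of G Y b] by (simp add: move_def le_SucI)

lemma birthday_GameI:
  assumes "\<And>X. X \<in> fset A \<union> fset B \<Longrightarrow> birthday X \<le> b"
  shows "birthday (Game A B) \<le> Suc b"
  unfolding birthday_le_iff
proof (intro allI impI)
  fix n X assume n: "(move ^^ n) (Game A B) X"
  show "n \<le> Suc b"
  proof (cases n)
    case (Suc m)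
    then obtain Y where "move (Game A B) Y" "(move ^^ m) Y X"
      using n by (metis relpowp_Suc_D2)
    then show ?thesis using Suc assms birthday_le_iff by (auto simp: move_def)
  qed simp
qed

lemma birthday_empty: "birthday (Game {||} {||}) \<le> b"
  unfolding birthday_le_iff
proof (intro allI impI)
  fix n X assume n: "(move ^^ n) (Game {||} {||}) X"
  show "n \<le> b"
  proof (cases n)
    case (Suc m)
    then obtain Y where "move (Game {||} {||}) Y" using n by (metis relpowp_Suc_D2)
    then show ?thesis by (simp add: move_def)
  qed simp
qed

lemma birthday_neg_int: "birthday (neg_int k) \<le> k"
proof (induction k)
  case 0
  show ?case using birthday_empty[of 0] by simp
qed (auto intro: birthday_GameI)

lemma birthday_hot: "(\<And>a. a \<in> fset A \<Longrightarrow> birthday a \<le> b) \<Longrightarrow> birthday (hot A b) \<le> Suc b"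
  unfolding hot_def using birthday_neg_int by (intro birthday_GameI) auto

text \<open>The assumption \<open>threat\<close> forces every position equal to an element of \<open>A\<close> to have at least three
  blue vertices.\<close>

locale hot_antichain =
  fixes A :: "game fset" and b :: nat and c :: "'v \<Rightarrow> colour" and N :: "'v \<Rightarrow> 'v set"
  assumes born: "a \<in> fset A \<Longrightarrow> birthday a \<le> b"
    and antichain: "a \<in> fset A \<Longrightarrow> a' \<in> fset A \<Longrightarrow> a \<le>\<^sub>g a' \<Longrightarrow> a = a'"
    and threat: "a \<in> fset A \<Longrightarrow> \<exists>l \<in> fset (left_opts a).
      pos_int 1 \<in> fset (left_opts l) \<and> (\<forall>Z \<in> fset (right_opts l). \<not> Z \<le>\<^sub>g a)"
begin

abbreviation game_on :: "'v set \<Rightarrow> game" where "game_on \<equiv> digraph_game c N"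
abbreviation after :: "'v set \<Rightarrow> 'v \<Rightarrow> 'v set" where "after S v \<equiv> S - insert v (N v)"

text \<open>For \<open>game_on S\<close> below \<open>hot A b\<close>, each of these elements lies
  below the result of some blue move, by \<open>covered_subset\<close>. The negated form passes
  directly to the position after a reversal.\<close>

definition covered :: "'v set \<Rightarrow> game set" where
  "covered S = {a \<in> fset A. \<not> game_on S \<le>\<^sub>g a}"

definition covered_by :: "'v set \<Rightarrow> 'v \<Rightarrow> game set" where
  "covered_by S v = {a \<in> fset A. a \<le>\<^sub>g game_on (after S v)}"

lemma finite_covered [simp]: "finite (covered S)" "finite (covered_by S v)"
  by (simp_all add: covered_def covered_by_def)

lemma not_le_hot: "a \<in> fset A \<Longrightarrow> \<not> a \<le>\<^sub>g hot A b"
  using le_hot[of a A b] neg_int_le[OF born] by blast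

text \<open>Left must match \<open>l\<close> with one blue vertex and its option 1 with a second,
  and a game at least 1 contains a third. A Right option of \<open>l\<close> cannot replace the
  first of these moves, since by \<open>threat\<close> none lies below \<open>a\<close>.\<close>

lemma card_blues_of_option:
  assumes S: "finite S" and a: "a \<in> fset A" "a \<le>\<^sub>g game_on S" "game_on S \<le>\<^sub>g a"
  shows "3 \<le> card (blues c S)"
proof -
  obtain l where l: "l \<in> fset (left_opts a)" "pos_int 1 \<in> fset (left_opts l)"
    "\<And>Z. Z \<in> fset (right_opts l) \<Longrightarrow> \<not> Z \<le>\<^sub>g a"
    using threat[OF a(1)] by blast
  have "\<not> game_on S \<le>\<^sub>g l" using not_left_opt_ge[OF l(1)] game_le_trans[OF a(2)] by blast
  then obtain X where "X \<in> fset (left_opts (game_on S))" "l \<le>\<^sub>g X"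
  proof (cases rule: not_game_leE)
    case (2 Z)
    then show ?thesis using l(3) game_le_trans[OF _ a(3)] by blast
  qed
  then obtain x where x: "x \<in> blues c S" "l \<le>\<^sub>g game_on (after S x)"
    using S by (auto simp: digraph_game_opts)
  have "\<not> game_on (after S x) \<le>\<^sub>g pos_int 1" by (rule game_le_left[OF x(2) l(2)])
  then obtain Y where "Y \<in> fset (left_opts (game_on (after S x)))" "pos_int 1 \<le>\<^sub>g Y"
    by (cases rule: not_game_leE) simp_all
  then obtain y where y: "y \<in> blues c (after S x)" "pos_int 1 \<le>\<^sub>g game_on (after (after S x) y)"
    using S by (auto simp: digraph_game_opts)
  have "1 \<le> card (blues c (after (after S x) y))"
    by (rule pos_int_le_card_blues[OF _ y(2)]) (use S in simp)
  moreover have "card (blues c (after (after S x) y)) < card (blues c (after S x))"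
    using y(1) S by (intro card_colour_delete_less) auto
  moreover have "card (blues c (after S x)) < card (blues c S)"
    using x(1) S by (intro card_colour_delete_less) auto
  ultimately show ?thesis by linarith
qed

text \<open>Failure of \<open>game_on S \<le> a\<close> is witnessed by a Left move or by a Right
  option of \<open>a\<close> below \<open>game_on S\<close>. The latter would lie below
  \<open>hot A b\<close>, yet as a game born by day \<open>b\<close> it is at least
  \<open>-b\<close>.\<close>

lemma covered_subset:
  assumes S: "finite S" "game_on S \<le>\<^sub>g hot A b"
  shows "covered S \<subseteq> (\<Union>v \<in> blues c S. covered_by S v)"
proof
  fix a assume "a \<in> covered S"
  then have a: "a \<in> fset A" "\<not> game_on S \<le>\<^sub>g a" by (auto simp: covered_def)
  have below: "\<not> Z \<le>\<^sub>g game_on S" if "Z \<in> fset (right_opts a)" for Z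
  proof
    assume "Z \<le>\<^sub>g game_on S"
    then have "Z \<le>\<^sub>g hot A b" using S(2) by (rule game_le_trans)
    moreover have "neg_int b \<le>\<^sub>g Z" by (rule neg_int_le[OF birthday_right[OF that born[OF a(1)]]])
    ultimately show False using le_hot by blast
  qed
  from a(2) obtain X where "X \<in> fset (left_opts (game_on S))" "a \<le>\<^sub>g X"
  proof (cases rule: not_game_leE)
    case (2 Y)
    then show ?thesis using below by blast
  qed
  then show "a \<in> (\<Union>v \<in> blues c S. covered_by S v)"
    using a S(1) by (auto simp: digraph_game_opts covered_by_def)
qed

text \<open>In the second case the Left move to \<open>S - v\<close> is reversible. If Left's move removed no red
  vertex, or Right's reply no blue one, then monotonicity would put the position after Left's move
  below \<open>hot A b\<close>, but it lies above an element of \<open>A\<close>. So a reversal costs two vertices of each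
  colour.\<close>

lemma covered_by_cases:
  assumes S: "finite S" "game_on S \<le>\<^sub>g hot A b" and v: "v \<in> blues c S"
    and nonempty: "covered_by S v \<noteq> {}"
  obtains (option) a where "covered_by S v \<subseteq> {a}" "4 \<le> card (blues c S)"
    | (reversal) T where "finite T" "game_on T \<le>\<^sub>g hot A b" "covered_by S v \<subseteq> covered T"
        "card (blues c T) + 2 \<le> card (blues c S)" "card (reds c T) + 2 \<le> card (reds c S)"
proof -
  let ?Z = "after S v"
  have "game_on ?Z \<in> fset (left_opts (game_on S))"
    using v S(1) by (auto simp: digraph_game_opts)
  then have "\<not> hot A b \<le>\<^sub>g game_on ?Z" using S(2) game_le_left by blast
  \<comment> \<open>Either an element of \<open>A\<close> dominates the result of Left's move, or
    Right has a reply that returns below \<open>hot A b\<close>.\<close>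
  then consider (L) a where "a \<in> fset A" "game_on ?Z \<le>\<^sub>g a"
    | (R) Y where "Y \<in> fset (right_opts (game_on ?Z))" "Y \<le>\<^sub>g hot A b"
    by (auto simp: hot_def elim!: not_game_leE)
  then show thesis
  proof cases
    case L
    \<comment> \<open>Every element covered by \<open>v\<close> lies below
      \<open>game_on ?Z\<close>, hence below \<open>a\<close>, and is \<open>a\<close> by the
      antichain property. So \<open>game_on ?Z\<close> has the value of \<open>a\<close>, which
      costs three blue vertices besides \<open>v\<close>.\<close>
    have sub: "covered_by S v \<subseteq> {a}"
      using antichain[OF _ L(1)] game_le_trans[OF _ L(2)] by (auto simp: covered_by_def)
    then have a: "a \<le>\<^sub>g game_on ?Z" using nonempty by (auto simp: covered_by_def)
    have "3 \<le> card (blues c ?Z)"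
      by (rule card_blues_of_option[OF _ L(1) a L(2)]) (use S(1) in simp)
    also have "\<dots> < card (blues c S)" using v S(1) by (intro card_colour_delete_less) auto
    finally show thesis using sub option by simp
  next
    case R
    then obtain u where u: "u \<in> reds c ?Z" "game_on (after ?Z u) \<le>\<^sub>g hot A b"
      using S(1) by (auto simp: digraph_game_opts)
    let ?T = "after ?Z u"
    obtain a where a: "a \<in> fset A" "a \<le>\<^sub>g game_on ?Z" using nonempty by (auto simp: covered_by_def)
    have "\<not> game_on ?Z \<le>\<^sub>g hot A b" using not_le_hot[OF a(1)] game_le_trans[OF a(2)] by blast
    then have "\<not> game_on ?Z \<le>\<^sub>g game_on S" "\<not> game_on ?Z \<le>\<^sub>g game_on ?T"
      using game_le_trans[OF _ S(2)] game_le_trans[OF _ u(2)] by blast+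
    then have "\<not> reds c S \<subseteq> ?Z" "\<not> blues c ?Z \<subseteq> ?T"
      using digraph_game_mono[of S ?Z c N] digraph_game_mono[of ?T ?Z c N] S(1) by blast+
    then obtain r s where rs: "r \<in> reds c S" "r \<notin> ?Z" "s \<in> blues c ?Z" "s \<notin> ?T" by auto
    have "card (insert s (insert v (blues c ?T))) \<le> card (blues c S)"
      using v rs S(1) by (intro card_mono) auto
    moreover have "card (insert s (insert v (blues c ?T))) = card (blues c ?T) + 2"
      using v rs S(1) by (subst card_insert_disjoint; auto)+
    moreover have "card (insert r (insert u (reds c ?T))) \<le> card (reds c S)"
      using u rs S(1) by (intro card_mono) auto
    moreover have "card (insert r (insert u (reds c ?T))) = card (reds c ?T) + 2"
      using u rs S(1) by (subst card_insert_disjoint; auto)+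
    moreover have "covered_by S v \<subseteq> covered ?T"
    proof -
      have "game_on ?T \<in> fset (right_opts (game_on ?Z))"
        using u S(1) by (auto simp: digraph_game_opts)
      then have "\<not> game_on ?T \<le>\<^sub>g game_on ?Z" by (rule not_right_opt_le)
      then have "\<not> game_on ?T \<le>\<^sub>g a" if "a \<le>\<^sub>g game_on ?Z" for a
        using game_le_trans[OF _ that] by blast
      then show ?thesis by (auto simp: covered_def covered_by_def)
    qed
    ultimately show thesis using reversal[of ?T] S(1) u(2) by auto
  qed
qed

text \<open>Reversals preserve that something is covered and use up blue vertices, so a chain of
  them ends at a move equal in value to an element of \<open>A\<close>.\<close>

lemma covered_card_blues:
  assumes "finite S" "game_on S \<le>\<^sub>g hot A b" "covered S \<noteq> {}"
  shows "4 \<le> card (blues c S)"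
  using assms
proof (induction "card (blues c S)" arbitrary: S rule: less_induct)
  case less
  obtain v where v: "v \<in> blues c S" "covered_by S v \<noteq> {}"
    using less.prems covered_subset by blast
  from less.prems(1,2) v show ?case
  proof (cases rule: covered_by_cases)
    case (reversal T)
    then show ?thesis using less.hyps[of T] v(2) by force
  qed
qed

lemma card_covered_le:
  assumes S: "finite S" "game_on S \<le>\<^sub>g hot A b"
    and k: "\<And>v. v \<in> blues c S \<Longrightarrow> card (covered_by S v) \<le> k"
  shows "card (covered S) \<le> card (blues c S) * k"
proof -
  have "card (covered S) \<le> card (\<Union>v \<in> blues c S. covered_by S v)"
    using covered_subset[OF S] S(1) by (intro card_mono) auto
  also have "\<dots> \<le> (\<Sum>v \<in> blues c S. card (covered_by S v))"
    using S(1) by (intro card_UN_le) auto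
  also have "\<dots> \<le> card (blues c S) * k"
    using sum_bounded_above[of "blues c S" "\<lambda>v. card (covered_by S v)" k] k by simp
  finally show ?thesis .
qed

text \<open>A position after a reversal that still covers something has 4 blue and
  \<open>b + 1\<close> red vertices. Adding the two of each colour that the reversal costs gives the
  thresholds 6 and \<open>b + 3\<close>.\<close>

lemma card_covered_no_reversal:
  assumes S: "finite S" "game_on S \<le>\<^sub>g hot A b"
    and few: "card (blues c S) < 6 \<or> card (reds c S) < b + 3"
  shows "card (covered S) \<le> card (blues c S)"
proof -
  have "card (covered_by S v) \<le> 1" if v: "v \<in> blues c S" for v
  proof (cases "covered_by S v = {}")
    case False
    from S v False show ?thesis
    proof (cases rule: covered_by_cases)
      case (option a)
      then show ?thesis using card_mono[OF _ option(1)] by simp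
    next
      case (reversal T)
      then have "4 \<le> card (blues c T)" using False covered_card_blues by blast
      moreover have "b < card (reds c T)" using reversal le_hot_card_reds by blast
      ultimately show ?thesis using few reversal by linarith
    qed
  qed simp
  then show ?thesis using card_covered_le[OF S, of 1] by simp
qed

text \<open>A reversal lowers the thresholds to those of \<open>card_covered_no_reversal\<close>, so
  the position after it covers at most one element per remaining blue vertex. The 1 in the maximum
  accounts for a move without reversal.\<close>

lemma card_covered_one_reversal:
  assumes S: "finite S" "game_on S \<le>\<^sub>g hot A b"
    and few: "card (blues c S) < 8 \<or> card (reds c S) < b + 5"
  shows "card (covered S) \<le> card (blues c S) * max 1 (card (blues c S) - 2)"
proof -
  have "card (covered_by S v) \<le> max 1 (card (blues c S) - 2)" if v: "v \<in> blues c S" for v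
  proof (cases "covered_by S v = {}")
    case False
    from S v False show ?thesis
    proof (cases rule: covered_by_cases)
      case (option a)
      then show ?thesis using card_mono[OF _ option(1)] by simp
    next
      case (reversal T)
      have "card (covered_by S v) \<le> card (covered T)" using reversal by (intro card_mono) auto
      also have "\<dots> \<le> card (blues c T)"
        using reversal few by (intro card_covered_no_reversal) auto
      finally show ?thesis using reversal by linarith
    qed
  qed simp
  then show ?thesis by (rule card_covered_le[OF S])
qed

lemma card_options_le:
  assumes S: "finite S" "game_on S \<simeq> hot A b" and b: "b = 3" and n: "card S \<le> 15"
  shows "card (fset A) \<le> 63"
proof -
  have le: "game_on S \<le>\<^sub>g hot A b" "hot A b \<le>\<^sub>g game_on S" using S by (auto simp: game_eq_iff_le)
  have "fset A \<subseteq> covered S"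
  proof
    fix a assume a: "a \<in> fset A"
    then have "\<not> hot A b \<le>\<^sub>g a" by (intro not_left_opt_ge) (simp add: hot_def)
    then show "a \<in> covered S" unfolding covered_def using a game_le_trans[OF le(2)] by blast
  qed
  then have A: "card (fset A) \<le> card (covered S)" by (intro card_mono) auto
  let ?p = "card (blues c S)" and ?q = "card (reds c S)"
  have n: "?p + ?q \<le> 15" using card_blues_reds[OF S(1), of c] n by simp
  show ?thesis
  proof (cases "?p < 6 \<or> ?q < 6")
    case True
    then show ?thesis using A card_covered_no_reversal[OF S(1) le(1)] b n by linarith
  next
    case False
    then have p: "6 \<le> ?p" "?p \<le> 9" using n by auto
    \<comment> \<open>For \<open>b = 3\<close> both thresholds are 8, and 15 vertices cannot reach
      both.\<close>
    have "card (fset A) \<le> ?p * max 1 (?p - 2)"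
      using A card_covered_one_reversal[OF S(1) le(1)] b n by linarith
    also have "\<dots> \<le> 9 * 7" using p by (intro mult_mono) auto
    finally show ?thesis by simp
  qed
qed

end

section \<open>A large antichain of games born by day 3\<close>

text \<open>Options are lists here, so that the order can be computed by rewriting.\<close>

datatype lgame = LG (lefts: "lgame list") (rights: "lgame list")

primrec to_game :: "lgame \<Rightarrow> game" where
  "to_game (LG ls rs) = Game (fset_of_list (map to_game ls)) (fset_of_list (map to_game rs))"

text \<open>The conditional lets evaluation by rewriting settle the Left options before it turns to
  the Right options.\<close>

function lle :: "lgame \<Rightarrow> lgame \<Rightarrow> bool" where
  "lle G H \<longleftrightarrow>
     (if \<exists>X \<in> set (lefts G). lle H X then False else \<not> (\<exists>Y \<in> set (rights H). lle Y G))"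
  by pat_completeness auto
termination
proof (relation "measure (\<lambda>(G, H). size G + size H)")
  have "X \<in> set xs \<Longrightarrow> size X \<le> size_list size xs" for X :: lgame and xs
    by (induction xs) auto
  then have "X \<in> set (lefts G) \<union> set (rights G) \<Longrightarrow> size X < size G" for X G
    by (cases G) fastforce
  then show "((H, X), (G, H)) \<in> measure (\<lambda>(G, H). size G + size H)"
    if "X \<in> set (lefts G)" for G H X using that by fastforce
  from \<open>\<And>X G. X \<in> set (lefts G) \<union> set (rights G) \<Longrightarrow> size X < size G\<close>
  show "((Y, G), (G, H)) \<in> measure (\<lambda>(G, H). size G + size H)"
    if "Y \<in> set (rights H)" for G H Y using that by fastforce
qed simp

declare lle.simps [simp del]

lemma to_game_opts:
  "fset (left_opts (to_game G)) = to_game ` set (lefts G)"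
  "fset (right_opts (to_game G)) = to_game ` set (rights G)"
  by (cases G; simp add: fset_of_list.rep_eq)+

lemma lle_iff: "lle G H \<longleftrightarrow> to_game G \<le>\<^sub>g to_game H"
proof (induction G H rule: lle.induct)
  case (1 G H)
  then show ?case by (subst lle.simps, subst game_le.simps) (auto simp: to_game_opts)
qed

primrec born_by :: "nat \<Rightarrow> lgame \<Rightarrow> bool" where
  "born_by 0 G \<longleftrightarrow> lefts G = [] \<and> rights G = []"
| "born_by (Suc b) G \<longleftrightarrow> (\<forall>X \<in> set (lefts G). born_by b X) \<and> (\<forall>X \<in> set (rights G). born_by b X)"

lemma birthday_born_by: "born_by b G \<Longrightarrow> birthday (to_game G) \<le> b"
proof (induction b arbitrary: G)
  case 0
  then have "to_game G = Game {||} {||}" by (cases G) simp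
  then show ?case using birthday_empty[of 0] by simp
next
  case (Suc b)
  then show ?case
    by (cases G) (auto intro!: birthday_GameI simp: fset_of_list.rep_eq)
qed

text \<open>These are the values born by day 2, apart from 2, -2 and \<open>*2\<close>.\<close>

definition "l0 = LG [] []"
definition "l1 = LG [l0] []"
definition "m1 = LG [] [l0]"
definition "star = LG [l0] [l0]"
definition "up = LG [l0] [star]"
definition "dn = LG [star] [l0]"
definition "up_star = LG [l0, star] [l0]"
definition "dn_star = LG [l0] [l0, star]"
definition "half = LG [l0] [l1]"
definition "mhalf = LG [m1] [l0]"
definition "one_star = LG [l1] [l1]"
definition "mone_star = LG [m1] [m1]"
definition "pm1 = LG [l1] [m1]"
definition "one_0 = LG [l1] [l0]"
definition "one_star' = LG [l1] [star]"
definition "one_0_star = LG [l1] [l0, star]"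
definition "m_0 = LG [l0] [m1]"
definition "m_star = LG [star] [m1]"
definition "m_0_star = LG [l0, star] [m1]"

text \<open>Found by computing a maximum antichain among the games born by day 3 that
  satisfy the condition \<open>threat\<close>. That antichain has 66 elements; 64 of them suffice.\<close>

definition "day3 = concat (map (\<lambda>(ls, rs). map (case_prod LG) (List.product ls rs))
  [([[half, one_0_star], [up, one_0], [up_star, one_star']],
     [[star, m_star], [mhalf], [l0, m_0], [dn, dn_star, m_0_star]]),
   ([[up, up_star, one_0_star], [star, one_star'], [l0, one_0]],
     [[star, dn, m_0_star], [l0, dn_star, m_0_star], [dn, dn_star]]),
   ([[star, up, one_0_star], [l0, up_star, one_0_star]],
     [[star, l0, m_0_star], [star, dn], [l0, dn_star]]),
   ([[l1, one_0_star]],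
     [[pm1, m1], [mhalf, m_0_star], [dn, m_0], [dn_star, m_star]]),
   ([[half, one_0], [half, one_star'], [one_star', one_0]],
     [[m1], [mhalf, m_0_star], [dn, m_0], [dn_star, m_star]]),
   ([[l1, one_0], [l1, one_star'], [half, one_star', one_0]],
     [[m1, m_0_star], [mhalf, m_star], [mhalf, m_0], [m_star, m_0]]),
   ([[pm1, l1]],
     [[m1]]),
   ([[one_star], [l1, one_star', one_0]],
     [[m1, m_star], [m1, m_0], [mhalf, m_star, m_0]]),
   ([[l1, one_star]],
     [[m1, m_star, m_0], [mone_star]])])"

lemma day3_born: "list_all (born_by (Suc (Suc (Suc 0)))) day3"
  by code_simp

lemma length_day3: "length day3 = 64"
  by code_simp

text \<open>Both directions are tested because \<open>sorted_wrt\<close> visits each pair once.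
  Distinctness of the list then follows by reflexivity of the order.\<close>

lemma day3_antichain: "sorted_wrt (\<lambda>G H. \<not> lle G H \<and> \<not> lle H G) day3"
  by code_simp

lemma day3_threat: "list_all (\<lambda>G. list_ex (\<lambda>H. l1 \<in> set (lefts H) \<and> list_all (\<lambda>Z. \<not> lle Z G) (rights H)) (lefts G)) day3"
  by code_simp

section \<open>Lower bounds\<close>

text \<open>Comparable members are identical as games, not merely equal in value, so
  \<open>k\<close> also counts the values of the members.\<close>

definition wide :: "nat \<Rightarrow> nat \<Rightarrow> bool" where
  "wide b k \<longleftrightarrow> (\<exists>A. finite A \<and> card A = k \<and> (\<forall>a \<in> A. birthday a \<le> b) \<and>
     (\<forall>a \<in> A. \<forall>a' \<in> A. a \<le>\<^sub>g a' \<longrightarrow> a = a'))"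

lemma wide_mono: "wide b k \<Longrightarrow> k' \<le> k \<Longrightarrow> wide b k'"
proof -
  assume "wide b k" "k' \<le> k"
  then obtain A where A: "card A = k" "\<forall>a \<in> A. birthday a \<le> b"
    "\<forall>a \<in> A. \<forall>a' \<in> A. a \<le>\<^sub>g a' \<longrightarrow> a = a'"
    unfolding wide_def by blast
  obtain B where "B \<subseteq> A" "card B = k'" "finite B"
    using obtain_subset_with_card_n[of k' A] \<open>k' \<le> k\<close> A(1) by blast
  then show "wide b k'" unfolding wide_def using A(2,3) by (intro exI[of _ B]) blast
qed

text \<open>A Left option \<open>a\<close> of the smaller game must be matched by a member of
  \<open>T\<close> above it, which is \<open>a\<close> itself. A Right option of \<open>a\<close> is
  at least \<open>-b\<close> and so cannot lie below \<open>hot T b\<close>.\<close>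

lemma hot_le_hotD:
  assumes born: "\<And>a. a \<in> A \<Longrightarrow> birthday a \<le> b"
    and anti: "\<And>a a'. a \<in> A \<Longrightarrow> a' \<in> A \<Longrightarrow> a \<le>\<^sub>g a' \<Longrightarrow> a = a'"
    and ST: "fset S \<subseteq> A" "fset T \<subseteq> A" and le: "hot S b \<le>\<^sub>g hot T b"
  shows "fset S \<subseteq> fset T"
proof
  fix a assume a: "a \<in> fset S"
  then have "\<not> hot T b \<le>\<^sub>g a" using game_le_left[OF le] by (simp add: hot_def)
  then show "a \<in> fset T"
  proof (cases rule: not_game_leE)
    case (1 a')
    then show ?thesis using anti[of a a'] a ST by (auto simp: hot_def)
  next
    case (2 Z)
    have "birthday Z \<le> b" using birthday_right[OF 2(1)] born a ST by blast
    then show ?thesis using le_hot[OF 2(2)] neg_int_le by blast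
  qed
qed

lemma wide_card_values:
  assumes "wide b k"
  shows "2 ^ k \<le> card (values_born_by (Suc b))"
proof -
  obtain A where A: "finite A" "card A = k" "\<And>a. a \<in> A \<Longrightarrow> birthday a \<le> b"
    "\<And>a a'. a \<in> A \<Longrightarrow> a' \<in> A \<Longrightarrow> a \<le>\<^sub>g a' \<Longrightarrow> a = a'"
    using assms unfolding wide_def by blast
  let ?h = "\<lambda>S. value_of (hot (Abs_fset S) b)"
  have fin: "fset (Abs_fset S) = S" if "S \<subseteq> A" for S
    using finite_subset[OF that A(1)] by (simp add: Abs_fset_inverse)
  have "inj_on ?h (Pow A)"
  proof (rule inj_onI)
    fix S T assume ST: "S \<in> Pow A" "T \<in> Pow A" "?h S = ?h T"
    then have "hot (Abs_fset S) b \<le>\<^sub>g hot (Abs_fset T) b" "hot (Abs_fset T) b \<le>\<^sub>g hot (Abs_fset S) b"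
      by (simp_all add: value_of_eq_iff game_eq_iff_le)
    then show "S = T"
      using hot_le_hotD[OF A(3,4), where S = "Abs_fset S" and T = "Abs_fset T"]
        hot_le_hotD[OF A(3,4), where S = "Abs_fset T" and T = "Abs_fset S"] ST fin by auto
  qed
  then have "2 ^ k = card (?h ` Pow A)" using A(1,2) by (simp add: card_image card_Pow)
  also have "\<dots> \<le> card (values_born_by (Suc b))"
  proof (rule card_mono[OF finite_values_born_by])
    have "birthday (hot (Abs_fset S) b) \<le> Suc b" if "S \<subseteq> A" for S
      using fin[OF that] that A(3) by (intro birthday_hot) auto
    then show "?h ` Pow A \<subseteq> values_born_by (Suc b)" by (auto simp: values_born_by_def)
  qed
  finally show ?thesis .
qed

text \<open>Choosing one element from each of \<open>k\<close> disjoint pairs gives \<open>2 ^ k\<close> pairwise incomparable sets.\<close>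

lemma wide_Suc:
  assumes "wide b (2 * k)"
  shows "wide (Suc b) (2 ^ k)"
proof -
  obtain A where A: "finite A" "card A = 2 * k" "\<And>a. a \<in> A \<Longrightarrow> birthday a \<le> b"
    "\<And>a a'. a \<in> A \<Longrightarrow> a' \<in> A \<Longrightarrow> a \<le>\<^sub>g a' \<Longrightarrow> a = a'"
    using assms unfolding wide_def by blast
  obtain h where h: "bij_betw h {0..<2 * k} A"
    using ex_bij_betw_nat_finite[OF A(1)] A(2) by auto
  define pick where "pick T i = (if i \<in> T then 2 * i else 2 * i + 1)" for T and i :: nat
  define sel where "sel T = h ` pick T ` {..<k}" for T
  let ?h = "\<lambda>T. hot (Abs_fset (sel T)) b"
  have pick: "pick T i < 2 * k" if "i < k" for T i
    using that by (auto simp: pick_def)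
  have sub: "sel T \<subseteq> A" for T
    using h pick by (force simp: sel_def bij_betw_def)
  have fin: "fset (Abs_fset (sel T)) = sel T" for T
    by (simp add: Abs_fset_inverse sel_def)
  have incomparable: "T = T'" if "?h T \<le>\<^sub>g ?h T'" "T \<subseteq> {..<k}" "T' \<subseteq> {..<k}" for T T'
  proof -
    have "sel T \<subseteq> sel T'" using hot_le_hotD[OF A(3,4) _ _ that(1)] fin sub by simp
    have "pick T i = pick T' i" if i: "i < k" for i
    proof -
      have "h (pick T i) \<in> sel T'" using \<open>sel T \<subseteq> sel T'\<close> i by (auto simp: sel_def)
      then obtain j where j: "j < k" "h (pick T i) = h (pick T' j)" by (auto simp: sel_def)
      then have "pick T i = pick T' j"
        using h pick i by (auto simp: bij_betw_def dest!: inj_onD)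
      moreover from this have "i = j" by (auto simp: pick_def split: if_splits; presburger)
      ultimately show ?thesis by simp
    qed
    then have "i \<in> T \<longleftrightarrow> i \<in> T'" if "i < k" for i
      using that by (fastforce simp: pick_def split: if_splits)
    then show ?thesis using that by blast
  qed
  have "inj_on ?h (Pow {..<k})"
    by (rule inj_onI) (use incomparable game_le_refl in auto)
  then have "card (?h ` Pow {..<k}) = 2 ^ k" by (simp add: card_image card_Pow)
  moreover have "birthday (?h T) \<le> Suc b" for T
    using fin A(3)[OF subsetD[OF sub]] by (intro birthday_hot) auto
  ultimately show ?thesis
    unfolding wide_def using incomparable by (intro exI[of _ "?h ` Pow {..<k}"]) auto
qed

section \<open>Counting placement games\<close>

lemma card_values_le:
  assumes "max_placement_size b \<le> n"
  shows "card (values_born_by b) \<le> Suc n * 2 ^ (n * n)"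
proof -
  \<comment> \<open>One relation encodes a coloured digraph: its diagonal stores the blue vertices,
    as loops affect no move.\<close>
  let ?c = "\<lambda>R (i :: nat). if (i, i) \<in> R then Blue else Red"
  let ?N = "\<lambda>R (i :: nat). {j. (i, j) \<in> R}"
  let ?f = "\<lambda>(m, R). value_of (digraph_game (?c R) (?N R) {0..<m})"
  let ?D = "{..n} \<times> Pow ({0..<n} \<times> {0..<n})"
  have "values_born_by b \<subseteq> ?f ` ?D"
  proof
    fix x assume "x \<in> values_born_by b"
    then obtain G where G: "x = value_of G" "birthday G \<le> b" by (auto simp: values_born_by_def)
    obtain c N and S :: "nat set" where S: "finite S" "card S = placement_size (value_of G)"
      "digraph_game c N S \<simeq> G"
      by (rule placement_size_attained)
    then have n: "card S \<le> n" using placement_size_le_max[OF G(2)] assms by linarith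
    obtain h where h: "bij_betw h S {0..<card S}" using ex_bij_betw_finite_nat[OF S(1)] by blast
    define R where "R = {(h u, h v) | u v. u \<in> S \<and> v \<in> S \<and> (if u = v then c u = Blue else v \<in> N u)}"
    have inj: "inj_on h S" and img: "h ` S = {0..<card S}" using h by (auto simp: bij_betw_def)
    have R: "(h u, h v) \<in> R \<longleftrightarrow> (if u = v then c u = Blue else v \<in> N u)" if "u \<in> S" "v \<in> S" for u v
      using that inj_onD[OF inj] unfolding R_def by (auto split: if_splits; metis)
    have "digraph_game (?c R) (?N R) (h ` S) = digraph_game c N S"
      using S(1) inj R colour.exhaust by (intro digraph_game_relabel) (auto, metis colour.exhaust)
    then have "x = ?f (card S, R)" using S(3) G(1) img by (simp add: value_of_eq_iff game_eq_def)
    moreover have "R \<subseteq> {0..<n} \<times> {0..<n}"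
    proof -
      have "h u < n" if "u \<in> S" for u
        using imageI[OF that, of h] n unfolding img by simp
      then show ?thesis by (auto simp: R_def)
    qed
    ultimately show "x \<in> ?f ` ?D" using n by (intro image_eqI[of _ _ "(card S, R)"]) auto
  qed
  then have "card (values_born_by b) \<le> card (?f ` ?D)" by (intro card_mono) auto
  also have "\<dots> \<le> card ?D" by (intro card_image_le) auto
  also have "\<dots> = Suc n * 2 ^ (n * n)" by (simp add: card_cartesian_product card_Pow)
  finally show ?thesis .
qed

text \<open>For \<open>t = n + 1\<close> the exponent \<open>t ^ 2\<close> exceeds
  \<open>n * n\<close> by at least \<open>n + 1\<close>, which absorbs the factor
  \<open>n + 1 < 2 ^ (n + 1)\<close> for the number of vertices.\<close>

lemma wide_max_placement_size:
  assumes "wide b (t ^ 2)"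
  shows "t \<le> max_placement_size (Suc b)"
proof (rule ccontr)
  assume "\<not> ?thesis"
  then obtain n where n: "t = Suc n" "max_placement_size (Suc b) \<le> n"
    by (cases t) auto
  have "2 ^ (t ^ 2) \<le> Suc n * 2 ^ (n * n)"
    using wide_card_values[OF assms] card_values_le[OF n(2)] by simp
  also have "\<dots> < 2 ^ Suc n * 2 ^ (n * n)" by (intro mult_strict_right_mono less_exp) simp
  also have "\<dots> = 2 ^ (Suc n + n * n)" by (simp only: power_add)
  also have "\<dots> \<le> 2 ^ (t ^ 2)" unfolding n(1) by (intro power_increasing) (auto simp: power2_eq_square)
  finally show False by simp
qed

lemma day3_antichain_games:
  "\<exists>A. card (fset A) = 64 \<and>
     (\<forall>a \<in> fset A. birthday a \<le> 3 \<and> (\<forall>a' \<in> fset A. a \<le>\<^sub>g a' \<longrightarrow> a = a') \<and>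
       (\<exists>l \<in> fset (left_opts a). pos_int 1 \<in> fset (left_opts l) \<and>
         (\<forall>Z \<in> fset (right_opts l). \<not> Z \<le>\<^sub>g a)))"
proof -
  define A where "A = fset_of_list (map to_game day3)"
  have A: "fset A = to_game ` set day3" by (simp add: A_def fset_of_list.rep_eq)
  have nth: "i = j" if "i < length day3" "j < length day3" "to_game (day3 ! i) \<le>\<^sub>g to_game (day3 ! j)" for i j
    using sorted_wrt_nth_less[OF day3_antichain, of i j] sorted_wrt_nth_less[OF day3_antichain, of j i]
      that by (cases i j rule: linorder_cases) (simp_all add: lle_iff)
  have le: "G = H" if GH: "G \<in> set day3" "H \<in> set day3" "to_game G \<le>\<^sub>g to_game H" for G H
  proof -
    obtain i j where "i < length day3" "j < length day3" "G = day3 ! i" "H = day3 ! j"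
      using GH(1,2) unfolding in_set_conv_nth by blast
    then show ?thesis using nth[of i j] GH(3) by simp
  qed
  have "distinct day3"
    unfolding distinct_conv_nth
  proof (intro allI impI)
    fix i j assume "i < length day3" "j < length day3" "i \<noteq> j"
    then show "day3 ! i \<noteq> day3 ! j" using nth[of i j] by auto
  qed
  then have "card (set day3) = 64" by (simp add: distinct_card length_day3)
  moreover have "inj_on to_game (set day3)"
    by (rule inj_onI, rule le) simp_all
  ultimately have "card (fset A) = 64" by (simp add: A card_image)
  moreover have "birthday a \<le> 3" if a: "a \<in> fset A" for a
  proof -
    obtain G where "a = to_game G" "G \<in> set day3" using a unfolding A by blast
    then have "born_by (Suc (Suc (Suc 0))) G" using day3_born by (simp only: list_all_iff)
    then show ?thesis using \<open>a = to_game G\<close> birthday_born_by[of 3 G] by (simp only: numeral_3_eq_3)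
  qed
  moreover have "a = a'" if "a \<in> fset A" "a' \<in> fset A" "a \<le>\<^sub>g a'" for a a'
    using that le unfolding A by blast
  moreover have "\<exists>l \<in> fset (left_opts a). pos_int 1 \<in> fset (left_opts l) \<and>
      (\<forall>Z \<in> fset (right_opts l). \<not> Z \<le>\<^sub>g a)" if a: "a \<in> fset A" for a
  proof -
    obtain G where G: "a = to_game G" "G \<in> set day3" using a unfolding A by blast
    then obtain H where H: "H \<in> set (lefts G)" "l1 \<in> set (lefts H)"
      "\<And>Z. Z \<in> set (rights H) \<Longrightarrow> \<not> lle Z G"
      using day3_threat unfolding list_all_iff list_ex_iff by blast
    have "pos_int 1 = to_game l1" by (simp add: l1_def l0_def)
    with G H show ?thesis
      by (intro bexI[of _ "to_game H"]) (auto simp: to_game_opts lle_iff)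
  qed
  ultimately show ?thesis by (intro exI[of _ A] conjI ballI impI) simp_all
qed

lemma wide_3: "wide 3 64"
proof -
  obtain A where "card (fset A) = 64"
    "\<forall>a \<in> fset A. birthday a \<le> 3 \<and> (\<forall>a' \<in> fset A. a \<le>\<^sub>g a' \<longrightarrow> a = a')"
    using day3_antichain_games by fast
  then show ?thesis unfolding wide_def by (intro exI[of _ "fset A"]) simp
qed

lemma max_placement_size_4: "16 \<le> max_placement_size 4"
proof -
  obtain A where A: "card (fset A) = 64"
    "\<forall>a \<in> fset A. birthday a \<le> 3 \<and> (\<forall>a' \<in> fset A. a \<le>\<^sub>g a' \<longrightarrow> a = a') \<and>
       (\<exists>l \<in> fset (left_opts a). pos_int 1 \<in> fset (left_opts l) \<and>
         (\<forall>Z \<in> fset (right_opts l). \<not> Z \<le>\<^sub>g a))"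
    using day3_antichain_games by blast
  obtain c N and S :: "nat set" where S: "finite S" "card S = placement_size (value_of (hot A 3))"
    "digraph_game c N S \<simeq> hot A 3"
    by (rule placement_size_attained)
  interpret hot_antichain A 3 c N
    by unfold_locales (use A in blast)+
  have "\<not> card S \<le> 15" using card_options_le[OF S(1,3)] A(1) by auto
  moreover have "birthday (hot A 3) \<le> 4" using birthday_hot[of A 3] A(2) by simp
  ultimately show ?thesis using placement_size_le_max[of "hot A 3" 4] S(2) by linarith
qed

lemma Suc_Suc_le_max_placement_size: "b + 2 \<le> max_placement_size (Suc b)"
proof -
  let ?X = "hot {|pos_int 0|} b"
  obtain c N and S :: "nat set" where S: "finite S" "card S = placement_size (value_of ?X)"
    "digraph_game c N S \<simeq> ?X"
    by (rule placement_size_attained)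
  then have le: "digraph_game c N S \<le>\<^sub>g ?X" "?X \<le>\<^sub>g digraph_game c N S"
    by (auto simp: game_eq_iff_le)
  have "\<not> ?X \<le>\<^sub>g pos_int 0" by (rule not_left_opt_ge) (simp add: hot_def)
  then have "\<not> digraph_game c N S \<le>\<^sub>g pos_int 0" using game_le_trans[OF le(2)] by blast
  then obtain Y where "Y \<in> fset (left_opts (digraph_game c N S))"
    by (cases rule: not_game_leE) auto
  then have "blues c S \<noteq> {}" using S(1) by (auto simp: digraph_game_opts)
  then have "0 < card (blues c S)" using S(1) by (simp add: card_gt_0_iff)
  then have "b + 2 \<le> card S"
    using le_hot_card_reds[OF S(1) le(1)] card_blues_reds[OF S(1), of c] by linarith
  moreover have "birthday ?X \<le> Suc b" by (rule birthday_hot) (use birthday_empty in simp)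
  ultimately show ?thesis using placement_size_le_max[of ?X "Suc b"] S(2) by linarith
qed

text \<open>The index is shifted: there are \<open>n + 1\<close> occurrences of 2, and the value is
  the bound for day \<open>n + 2\<close>.\<close>

definition nat_tower :: "nat \<Rightarrow> nat" where
  "nat_tower n = ((\<lambda>x. 2 ^ x) ^^ n) 2"

lemma nat_tower_simps: "nat_tower 0 = 2" "nat_tower (Suc n) = 2 ^ nat_tower n"
  by (simp_all add: nat_tower_def)

lemma tower_eq_nat_tower: "tower 2 (Suc n) = real (nat_tower n)"
proof -
  have "((\<lambda>x. 2 powr x) ^^ n) (2 :: real) = real (nat_tower n)"
    by (induction n) (simp_all add: nat_tower_simps powr_realpow)
  then show ?thesis by (simp add: tower_def)
qed

lemma four_le_nat_tower: "4 \<le> nat_tower (Suc n)"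
proof (induction n)
  case (Suc n)
  then show ?case
    using less_exp[of "nat_tower (Suc n)"] nat_tower_simps(2)[of "Suc n"] by linarith
qed (simp add: nat_tower_simps)

text \<open>The square is the form that \<open>wide_max_placement_size\<close> takes, and it
  reproduces itself: \<open>t ^ 2\<close> games yield \<open>2 ^ (t ^ 2 div 2)\<close> on the next
  day, and \<open>t ^ 2 div 2\<close> is at least \<open>2 * t\<close> once \<open>t\<close> is at
  least 4.\<close>

lemma wide_nat_tower: "wide (n + 4) (nat_tower (n + 3) ^ 2)"
proof (induction n)
  case 0
  have "wide (Suc 3) (2 ^ 32)" by (rule wide_Suc) (use wide_3 in simp)
  moreover have "nat_tower 3 = 2 ^ 16" by (simp add: numeral_3_eq_3 nat_tower_simps)
  ultimately show ?case by simp
next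
  case (Suc n)
  define t where "t = nat_tower (n + 3)"
  have "even t" by (simp add: t_def nat_tower_simps numeral_3_eq_3)
  then obtain k where k: "t = 2 * k" by (elim evenE)
  have "4 \<le> t" using four_le_nat_tower[of "n + 2"] by (simp add: t_def numeral_3_eq_3)
  then have "2 \<le> k" using k by simp
  have "t ^ 2 = 2 * (2 * k * k)" by (simp add: k power2_eq_square)
  then have "wide (n + 4) (2 * (2 * k * k))" using Suc by (simp only: t_def)
  then have "wide (Suc (n + 4)) (2 ^ (2 * k * k))" by (rule wide_Suc)
  moreover have "(2 ^ t) ^ 2 \<le> (2 :: nat) ^ (2 * k * k)"
  proof -
    have "t * 2 \<le> 2 * k * k" using \<open>2 \<le> k\<close> by (simp add: k)
    then show ?thesis by (simp only: power_mult[symmetric]) (intro power_increasing, auto)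
  qed
  moreover have "nat_tower (Suc n + 3) = 2 ^ t" using nat_tower_simps(2)[of "n + 3"] by (simp add: t_def)
  ultimately show ?case using wide_mono by simp
qed

theorem theorem11:
  fixes b :: nat
  assumes "b \<ge> 2"
  shows "real (max_placement_size b) \<ge> tower 2 (b - 1)"
proof -
  obtain n where n: "b = n + 2" using assms le_Suc_ex by (metis add.commute)
  have "nat_tower n \<le> max_placement_size (n + 2)"
  proof -
    \<comment> \<open>The first three cases are days 2, 3 and 4; in the last one the antichain of
      day \<open>m + 4\<close> bounds day \<open>m + 5\<close>.\<close>
    consider "n = 0" | "n = 1" | "n = 2" | m where "n = m + 3"
      using le_Suc_ex[of 3 n] by (force simp: not_le less_Suc_eq numeral_3_eq_3)
    then show ?thesis
    proof cases
      case 1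
      then show ?thesis using Suc_Suc_le_max_placement_size[of 1] by (simp add: nat_tower_simps numeral_2_eq_2)
    next
      case 2
      then show ?thesis
        using Suc_Suc_le_max_placement_size[of 2] by (simp add: nat_tower_simps numeral_3_eq_3)
    next
      case 3
      have "nat_tower (Suc (Suc 0)) = 16" by (simp add: nat_tower_simps)
      then have "nat_tower 2 = 16" by (simp add: numeral_2_eq_2)
      then show ?thesis using 3 max_placement_size_4 by simp
    next
      case (4 m)
      then show ?thesis using wide_max_placement_size[OF wide_nat_tower[of m]] by simp
    qed
  qed
  then show ?thesis using tower_eq_nat_tower[of n] n by simp
qed

end
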